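(* Let $\sigma>0$ and $\lambda\in\mathcal D_\star$. Then for every $x\in\mathbb R$: $$\mathcal N_a(T,x)<\infty\ \text{ for all }T>0\quad\text{if }0\le a<\tfrac12,\qquad\mathcal N_a(T,x)=\infty\ \text{ for all }T>0\quad\text{if }a>\tfrac12.$$ Therefore $a=1/2$ is the unique value at which the finiteness of $\mathcal N_a(T,x)$ can depend on the horizon $T>0$.
   Context: Class $\mathcal D$: all $\lambda\in C^1(\mathbb R)$ that are strictly decreasing with $\lambda(\theta)=0$ for some (unique) $\theta\in\mathbb R$; $q:=-\lambda'$. Class $\mathcal D_\star$: all $\lambda\in\mathcal D$ that are superlinear, $|\lambda(y)|/|y-\theta|\to\infty$ as $|y-\theta|\to\infty$, and drift-dominated, $\limsup_{|y|\to\infty}\sigma^2q(y)/\lambda(y)^2=0$. For $\lambda\in\mathcal D$ the SDE $\mathrm dX_t=\lambda(X_t)\,\mathrm dt+\sigma\,\mathrm dW_t$, $X_0=x$ ($W$ a standard Brownian motion) has a unique non-explosive strong solution, and for $a\ge0$ $$\mathcal N_a(T,x):=\mathbb E_x\Big[\exp\Big\{a\int_0^T\frac{\lambda(X_s)^2}{\sigma^2}\,\mathrm ds\Big\}\Big]\in[1,\infty].$$ *)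

theory Defs
  imports "HOL-Probability.Probability"
begin

definition class_D :: "(real \<Rightarrow> real) set" where
  "class_D = {lam. lam C1_differentiable_on UNIV \<and> strict_antimono_on UNIV lam \<and> (\<exists>\<theta>. lam \<theta> = 0)}"

definition slope_q :: "(real \<Rightarrow> real) \<Rightarrow> real \<Rightarrow> real" where
  "slope_q lam y = - deriv lam y"

definition superlinear :: "(real \<Rightarrow> real) \<Rightarrow> bool" where
  "superlinear lam \<longleftrightarrow>
    (\<exists>\<theta>. lam \<theta> = 0 \<and>
      filterlim (\<lambda>y. \<bar>lam y\<bar> / \<bar>y - \<theta>\<bar>) at_top (filtercomap (\<lambda>y. \<bar>y - \<theta>\<bar>) at_top))"

text \<open>The filter \<open>at_infinity\<close> on the reals is the filter of \<open>\<bar>y\<bar> \<rightarrow> \<infinity>\<close> (both ends).\<close>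

definition drift_dominated :: "real \<Rightarrow> (real \<Rightarrow> real) \<Rightarrow> bool" where
  "drift_dominated \<sigma> lam \<longleftrightarrow>
    Limsup at_infinity (\<lambda>y. ereal (\<sigma>\<^sup>2 * slope_q lam y / (lam y)\<^sup>2)) = 0"

definition class_D_star :: "real \<Rightarrow> (real \<Rightarrow> real) set" where
  "class_D_star \<sigma> = {lam \<in> class_D. superlinear lam \<and> drift_dominated \<sigma> lam}"

text \<open>Processes are indexed by all reals, but only times \<open>t \<ge> 0\<close> are ever constrained or used.\<close>

definition standard_brownian_motion :: "'w measure \<Rightarrow> (real \<Rightarrow> 'w \<Rightarrow> real) \<Rightarrow> bool" where
  "standard_brownian_motion M W \<longleftrightarrow>
    prob_space M \<and>
    (\<forall>t\<ge>0. W t \<in> borel_measurable M) \<and>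
    (AE \<omega> in M. W 0 \<omega> = 0) \<and>
    (\<forall>s t. 0 \<le> s \<and> s < t \<longrightarrow>
      distributed M lborel (\<lambda>\<omega>. W t \<omega> - W s \<omega>) (normal_density 0 (sqrt (t - s)))) \<and>
    (\<forall>(n::nat) u. 0 \<le> u 0 \<and> (\<forall>i<n. u i < u (Suc i)) \<longrightarrow>
      prob_space.indep_vars M (\<lambda>_. borel) (\<lambda>i \<omega>. W (u (Suc i)) \<omega> - W (u i) \<omega>) {..<n}) \<and>
    (AE \<omega> in M. continuous_on {0..} (\<lambda>t. W t \<omega>))"

text \<open>The natural filtration of \<open>W\<close>, augmented by the null sets of \<open>M\<close>.\<close>

definition augmented_filtration :: "'w measure \<Rightarrow> (real \<Rightarrow> 'w \<Rightarrow> real) \<Rightarrow> real \<Rightarrow> 'w measure" where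
  "augmented_filtration M W t =
    sigma (space M) ({W s -` B \<inter> space M | s B. 0 \<le> s \<and> s \<le> t \<and> B \<in> sets borel} \<union> null_sets M)"

text \<open>
  A non-explosive strong solution of \<open>dX = lam(X) dt + \<sigma> dW\<close>, \<open>X 0 = x\<close>, driven by \<open>W\<close>.
  The noise is additive, so the stochastic integral of the constant \<open>\<sigma>\<close> over \<open>[0,t]\<close>
  is \<open>\<sigma> (W t - W 0) = \<sigma> W t\<close> almost surely.
\<close>

definition strong_solution ::
  "'w measure \<Rightarrow> (real \<Rightarrow> 'w \<Rightarrow> real) \<Rightarrow> (real \<Rightarrow> real) \<Rightarrow> real \<Rightarrow> real \<Rightarrow> (real \<Rightarrow> 'w \<Rightarrow> real) \<Rightarrow> bool" where
  "strong_solution M W lam \<sigma> x X \<longleftrightarrow>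
    (\<forall>t\<ge>0. X t \<in> borel_measurable (augmented_filtration M W t)) \<and>
    (AE \<omega> in M. continuous_on {0..} (\<lambda>t. X t \<omega>)) \<and>
    (AE \<omega> in M. \<forall>t\<ge>0. X t \<omega> = x + (LINT s:{0..t}|lborel. lam (X s \<omega>)) + \<sigma> * W t \<omega>)"

text \<open>
  The functional \<open>\<N>\<^sub>a(T,x)\<close>, with the dependence on the initial point \<open>x\<close> carried by the
  solution \<open>X\<close> started at \<open>x\<close>.
\<close>

definition drift_exp_moment ::
  "'w measure \<Rightarrow> (real \<Rightarrow> real) \<Rightarrow> real \<Rightarrow> (real \<Rightarrow> 'w \<Rightarrow> real) \<Rightarrow> real \<Rightarrow> real \<Rightarrow> ennreal" where
  "drift_exp_moment M lam \<sigma> X a T =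
    (\<integral>\<^sup>+\<omega>. ennreal (exp (a * (LINT s:{0..T}|lborel. (lam (X s \<omega>))\<^sup>2 / \<sigma>\<^sup>2))) \<partial>M)"

end

(*
  Write F for the antiderivative of lam / sigma^2. Formally, Girsanov's theorem and Ito's formula give
    E exp(1/2 * int lam(X)^2/sigma^2 - 1/2 * int q(X) + F(x) - F(X_T)) <= 1,
  and -F is bounded below while q is at most eps * lam^2/sigma^2 + C: this is finiteness for a < 1/2.
  Stochastic calculus is replaced by an Euler scheme with clamped drift and the exact one-step identity
  for Gaussian exponentials whose exponent carries an extra term c xi^2 / 2 with c slightly above q.
  That term dominates the second-order Taylor remainder path by path, so no quadratic variation limit
  is needed, and Fatou's lemma (first in the mesh, then in the clamping level) concludes.

  For a > 1/2, put lam R close to - sigma k. If W stays within d = c0 / k of the line k t on [0,T],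
  then X climbs to R in a short time (superlinearity) and stays above R - 2 sigma d, where |lam| is
  still close to sigma k (drift domination). The tube has probability at least
  const * exp(- k^2 T / 2 - 4 T / d^2), which for large c0 is beaten by the gain exp(a k^2 T (1 - small)).
*)
theory Submission
  imports Defs
begin

section \<open>Gaussian increments and chains driven by them\<close>

text \<open>The critical value is a matter of budget: \<open>a * lam^2\<close> plus half of a slope
  allowance \<open>(1 - 2 * a) * lam^2\<close> is exactly \<open>lam^2 / 2\<close>, the Girsanov
  term. Every \<open>a < 1/2\<close> leaves a positive share for q, and drift domination keeps q
  within that share up to a constant. Clamping is forced by the exact Gaussian formula, which needs
  \<open>c * h < 1\<close> while \<open>c\<close> grows like \<open>lam^2\<close>; it also makes the
  drift globally Lipschitz, so that the Euler scheme converges path by path. It can be removed at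
  the end because the final exponent \<open>V x + (C + 1) / 2 * T + 2\<close> contains no clamping
  data. For \<open>a > 1/2\<close> the width of order \<open>1 / k\<close> is dictated from both
  sides. A tube of smaller order costs more than any multiple of \<open>k^2\<close>. Over a longer
  stretch drift domination, which is a Lipschitz bound for \<open>1 / lam\<close>, no longer
  guarantees that the drift stays within a factor close to 1.\<close>

definition gauss :: "real \<Rightarrow> real measure" where
  "gauss h = density lborel (\<lambda>y. ennreal (normal_density 0 (sqrt h) y))"

lemma sets_gauss [simp, measurable_cong]: "sets (gauss h) = sets borel"
  by (simp add: gauss_def)

lemma space_gauss [simp]: "space (gauss h) = UNIV"
  by (simp add: gauss_def)

lemma prob_space_gauss: "0 < h \<Longrightarrow> prob_space (gauss h)"
  unfolding gauss_def by (rule prob_space_normal_density) simp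

text \<open>Completing the square turns density times integrand into a constant times the normal
  density of variance \<open>h / (1 - c * h)\<close>. A negative \<open>c\<close> serves the tube
  estimate, a positive one the Girsanov factor, where \<open>c * h < 1\<close> is a genuine
  constraint on the mesh.\<close>

lemma nn_integral_gauss_exp_quadratic:
  assumes h: "0 < h" and ch: "c * h < 1"
  shows "(\<integral>\<^sup>+y. ennreal (exp (b * y + c / 2 * y\<^sup>2)) \<partial>gauss h)
    = ennreal (exp (b\<^sup>2 * h / (2 * (1 - c * h))) / sqrt (1 - c * h))"
proof -
  define v where "v = h / (1 - c * h)"
  have v: "v > 0" using h ch by (simp add: v_def)
  define K where "K = exp (b\<^sup>2 * h / (2 * (1 - c * h))) / sqrt (1 - c * h)"
  have K0: "K \<ge> 0" using ch by (simp add: K_def)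
  have eq: "normal_density 0 (sqrt h) y * exp (b * y + c / 2 * y\<^sup>2)
      = K * normal_density (b * v) (sqrt v) y" for y
  proof -
    have "sqrt (2 * pi * v) * sqrt (1 - c * h) = sqrt (2 * pi * h)"
      using ch h by (simp add: v_def flip: real_sqrt_mult)
    then have s: "1 / sqrt (2 * pi * h) = 1 / (sqrt (1 - c * h) * sqrt (2 * pi * v))"
      by (simp add: mult.commute)
    have inv: "1 / v = 1 / h - c" using h ch by (simp add: v_def field_simps)
    have "(y - b * v)\<^sup>2 / (2 * v) = y\<^sup>2 / 2 * (1 / v) - b * y + b\<^sup>2 * v / 2"
      using v by (simp add: field_simps power2_eq_square)
    then have e: "- y\<^sup>2 / (2 * h) + (b * y + c / 2 * y\<^sup>2) = b\<^sup>2 * v / 2 - (y - b * v)\<^sup>2 / (2 * v)"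
      unfolding inv by (simp add: field_simps)
    have e3: "b\<^sup>2 * v / 2 = b\<^sup>2 * h / (2 * (1 - c * h))" by (simp add: v_def)
    have e2: "exp (- y\<^sup>2 / (2 * h)) * exp (b * y + c / 2 * y\<^sup>2)
      = exp (b\<^sup>2 * h / (2 * (1 - c * h))) * exp (- (y - b * v)\<^sup>2 / (2 * v))"
      by (simp only: exp_add[symmetric] e e3 diff_conv_add_uminus minus_divide_left)
    have "normal_density 0 (sqrt h) y * exp (b * y + c / 2 * y\<^sup>2)
      = 1 / sqrt (2 * pi * h) * (exp (- y\<^sup>2 / (2 * h)) * exp (b * y + c / 2 * y\<^sup>2))"
      using h by (simp add: normal_density_def)
    also have "\<dots> = K * normal_density (b * v) (sqrt v) y"
      unfolding e2 s using v by (simp add: normal_density_def K_def)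
    finally show ?thesis .
  qed
  have "(\<integral>\<^sup>+y. ennreal (exp (b * y + c / 2 * y\<^sup>2)) \<partial>gauss h)
     = (\<integral>\<^sup>+y. ennreal (normal_density 0 (sqrt h) y) * ennreal (exp (b * y + c / 2 * y\<^sup>2)) \<partial>lborel)"
    unfolding gauss_def by (rule nn_integral_density) auto
  also have "\<dots> = (\<integral>\<^sup>+y. ennreal K * ennreal (normal_density (b * v) (sqrt v) y) \<partial>lborel)"
    using K0 by (simp flip: ennreal_mult' eq)
  also have "\<dots> = ennreal K * (\<integral>\<^sup>+y. ennreal (normal_density (b * v) (sqrt v) y) \<partial>lborel)"
    by (rule nn_integral_cmult) auto
  also have "\<dots> = ennreal K"
    using v by (simp add: nn_integral_eq_integral)
  finally show ?thesis by (simp add: K_def)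
qed

section \<open>Recursions driven by noise increments, with multiplicative path weights\<close>

primrec chain :: "real \<Rightarrow> (real \<Rightarrow> real \<Rightarrow> real) \<Rightarrow> (nat \<Rightarrow> real) \<Rightarrow> nat \<Rightarrow> real" where
  "chain s0 st v 0 = s0"
| "chain s0 st v (Suc n) = st (chain s0 st v n) (v n)"

lemma chain_cong: "(\<And>i. i < n \<Longrightarrow> v i = w i) \<Longrightarrow> chain s0 st v n = chain s0 st w n"
  by (induction n) auto

lemma measurable_chain:
  assumes [measurable]: "case_prod st \<in> borel_measurable (borel \<Otimes>\<^sub>M borel)"
    and sb: "sets N = sets (borel :: real measure)" and "k \<le> n"
  shows "(\<lambda>v. chain s0 st v k) \<in> borel_measurable (Pi\<^sub>M {..<n} (\<lambda>_. N))"
  using \<open>k \<le> n\<close>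
proof (induction k)
  case (Suc k)
  have [measurable]: "(\<lambda>v. v k) \<in> borel_measurable (Pi\<^sub>M {..<n} (\<lambda>_. N))"
    using measurable_component_singleton[of k "{..<n}" "\<lambda>_. N"] Suc.prems
    by (simp add: measurable_cong_sets[OF refl sb])
  have [measurable]: "(\<lambda>v. chain s0 st v k) \<in> borel_measurable (Pi\<^sub>M {..<n} (\<lambda>_. N))"
    using Suc by simp
  have "(\<lambda>v. case_prod st (chain s0 st v k, v k)) \<in> borel_measurable (Pi\<^sub>M {..<n} (\<lambda>_. N))"
    by measurable
  then show ?case by simp
qed simp

text \<open>A discrete Feynman-Kac weight: \<open>ph\<close> is the indicator of survival in the
  tube estimate and a Girsanov density in the Euler scheme. Values in \<open>ennreal\<close> give
  Tonelli and Fatou without integrability conditions.\<close>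

definition path_weight ::
  "real \<Rightarrow> (real \<Rightarrow> real \<Rightarrow> real) \<Rightarrow> (real \<Rightarrow> real \<Rightarrow> ennreal) \<Rightarrow> nat \<Rightarrow> (nat \<Rightarrow> real) \<Rightarrow> ennreal" where
  "path_weight s0 st ph n v = (\<Prod>i<n. ph (chain s0 st v i) (v i))"

lemma measurable_path_weight:
  assumes [measurable]: "case_prod st \<in> borel_measurable (borel \<Otimes>\<^sub>M borel)"
    "case_prod ph \<in> borel_measurable (borel \<Otimes>\<^sub>M borel)"
    and sb: "sets N = sets (borel :: real measure)"
  shows "path_weight s0 st ph n \<in> borel_measurable (Pi\<^sub>M {..<n} (\<lambda>_. N))"
  unfolding path_weight_def
proof (intro borel_measurable_prod_ennreal)
  fix i assume i: "i \<in> {..<n}"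
  have [measurable]: "(\<lambda>v. v i) \<in> borel_measurable (Pi\<^sub>M {..<n} (\<lambda>_. N))"
    using measurable_component_singleton[of i "{..<n}" "\<lambda>_. N"] i
    by (simp add: measurable_cong_sets[OF refl sb])
  have [measurable]: "(\<lambda>v. chain s0 st v i) \<in> borel_measurable (Pi\<^sub>M {..<n} (\<lambda>_. N))"
    using i by (intro measurable_chain sb) auto
  have "(\<lambda>v. case_prod ph (chain s0 st v i, v i)) \<in> borel_measurable (Pi\<^sub>M {..<n} (\<lambda>_. N))"
    by measurable
  then show "(\<lambda>v. ph (chain s0 st v i) (v i)) \<in> borel_measurable (Pi\<^sub>M {..<n} (\<lambda>_. N))" by simp
qed

text \<open>Markov property in integrated form: the chain up to time \<open>n\<close> and its first
  \<open>n\<close> factors ignore coordinate \<open>n\<close>, so Tonelli integrates the last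
  increment with the state frozen.\<close>

lemma nn_integral_path_weight_Suc:
  assumes st[measurable]: "case_prod st \<in> borel_measurable (borel \<Otimes>\<^sub>M borel)"
    and ph[measurable]: "case_prod ph \<in> borel_measurable (borel \<Otimes>\<^sub>M borel)"
    and [measurable]: "ps \<in> borel_measurable borel"
    and sb: "sets N = sets (borel :: real measure)" and pN: "prob_space N"
  shows "(\<integral>\<^sup>+v. path_weight s0 st ph (Suc n) v * ps (chain s0 st v (Suc n)) \<partial>Pi\<^sub>M {..<Suc n} (\<lambda>_. N))
    = (\<integral>\<^sup>+v. path_weight s0 st ph n v *
        (\<integral>\<^sup>+y. ph (chain s0 st v n) y * ps (st (chain s0 st v n) y) \<partial>N) \<partial>Pi\<^sub>M {..<n} (\<lambda>_. N))"
proof -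
  interpret prob_space N by fact
  interpret product_sigma_finite "\<lambda>_::nat. N" by unfold_locales
  let ?f = "\<lambda>v. path_weight s0 st ph (Suc n) v * ps (chain s0 st v (Suc n))"
  have [measurable]: "path_weight s0 st ph (Suc n) \<in> borel_measurable (Pi\<^sub>M {..<Suc n} (\<lambda>_. N))"
    "(\<lambda>v. chain s0 st v (Suc n)) \<in> borel_measurable (Pi\<^sub>M {..<Suc n} (\<lambda>_. N))"
    by (intro measurable_path_weight measurable_chain st ph sb order_refl)+
  have m: "?f \<in> borel_measurable (Pi\<^sub>M {..<Suc n} (\<lambda>_. N))" by measurable
  have c: "chain s0 st (v(n := y)) i = chain s0 st v i" if "i \<le> n" for v y i
    using that by (intro chain_cong) auto
  have "(\<integral>\<^sup>+v. ?f v \<partial>Pi\<^sub>M {..<Suc n} (\<lambda>_. N)) = (\<integral>\<^sup>+v. (\<integral>\<^sup>+y. ?f (v(n := y)) \<partial>N) \<partial>Pi\<^sub>M {..<n} (\<lambda>_. N))"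
    using product_nn_integral_insert[of "{..<n}" n ?f] m by (simp add: lessThan_Suc)
  also have "\<dots> = (\<integral>\<^sup>+v. (\<integral>\<^sup>+y. path_weight s0 st ph n v *
      (ph (chain s0 st v n) y * ps (st (chain s0 st v n) y)) \<partial>N) \<partial>Pi\<^sub>M {..<n} (\<lambda>_. N))"
    by (intro nn_integral_cong) (simp add: path_weight_def c mult.assoc)
  also have "\<dots> = (\<integral>\<^sup>+v. path_weight s0 st ph n v *
        (\<integral>\<^sup>+y. ph (chain s0 st v n) y * ps (st (chain s0 st v n) y) \<partial>N) \<partial>Pi\<^sub>M {..<n} (\<lambda>_. N))"
  proof (intro nn_integral_cong nn_integral_cmult)
    fix v
    have "(\<lambda>y. case_prod ph (chain s0 st v n, y) * ps (case_prod st (chain s0 st v n, y))) \<in> borel_measurable borel"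
      by measurable
    then show "(\<lambda>y. ph (chain s0 st v n) y * ps (st (chain s0 st v n) y)) \<in> borel_measurable N"
      by (simp add: measurable_cong_sets[OF sb refl])
  qed
  finally show ?thesis .
qed

lemma standard_brownian_motion_increments:
  assumes W: "standard_brownian_motion M W" and h: "0 < h"
  shows "(\<lambda>\<omega>. \<lambda>i\<in>{..<n}. W (real (Suc i) * h) \<omega> - W (real i * h) \<omega>)
      \<in> measurable M (Pi\<^sub>M {..<n} (\<lambda>_. borel))" (is "?D \<in> _")
    and "0 < n \<Longrightarrow> distr M (Pi\<^sub>M {..<n} (\<lambda>_. borel)) (\<lambda>\<omega>. \<lambda>i\<in>{..<n}. W (real (Suc i) * h) \<omega> - W (real i * h) \<omega>)
      = Pi\<^sub>M {..<n} (\<lambda>_. gauss h)"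
proof -
  have ps: "prob_space M" and Wm: "\<And>t. 0 \<le> t \<Longrightarrow> W t \<in> borel_measurable M"
    and d: "\<And>s t. 0 \<le> s \<Longrightarrow> s < t \<Longrightarrow>
      distributed M lborel (\<lambda>\<omega>. W t \<omega> - W s \<omega>) (normal_density 0 (sqrt (t - s)))"
    and i: "\<And>(n::nat) u. 0 \<le> u 0 \<Longrightarrow> (\<forall>i<n. u i < u (Suc i)) \<Longrightarrow>
      prob_space.indep_vars M (\<lambda>_. borel) (\<lambda>i \<omega>. W (u (Suc i)) \<omega> - W (u i) \<omega>) {..<n}"
    using W unfolding standard_brownian_motion_def by blast+
  interpret prob_space M by fact
  have rv: "(\<lambda>\<omega>. W (real (Suc i) * h) \<omega> - W (real i * h) \<omega>) \<in> borel_measurable M" for i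
    using h by (intro borel_measurable_diff Wm) auto
  show "?D \<in> measurable M (Pi\<^sub>M {..<n} (\<lambda>_. borel))"
    by (intro measurable_restrict rv)
  \<comment> \<open>The characterisation of independence by the joint law requires a nonempty index
    set.\<close>
  assume n: "0 < n"
  have "indep_vars (\<lambda>_. borel) (\<lambda>i \<omega>. W (real (Suc i) * h) \<omega> - W (real i * h) \<omega>) {..<n}"
    using i[of "\<lambda>i. real i * h" n] h by simp
  then have "distr M (Pi\<^sub>M {..<n} (\<lambda>_. borel)) ?D
    = Pi\<^sub>M {..<n} (\<lambda>i. distr M borel (\<lambda>\<omega>. W (real (Suc i) * h) \<omega> - W (real i * h) \<omega>))"
    using n rv by (subst (asm) indep_vars_iff_distr_eq_PiM) auto
  also have "\<dots> = Pi\<^sub>M {..<n} (\<lambda>_. gauss h)"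
  proof (intro PiM_cong refl)
    fix i
    have "distr M borel (\<lambda>\<omega>. W (real (Suc i) * h) \<omega> - W (real i * h) \<omega>)
      = distr M lborel (\<lambda>\<omega>. W (real (Suc i) * h) \<omega> - W (real i * h) \<omega>)"
      by (intro distr_cong) auto
    also have "\<dots> = density lborel (normal_density 0 (sqrt (real (Suc i) * h - real i * h)))"
      using h by (intro distributed_distr_eq_density d) auto
    finally show "distr M borel (\<lambda>\<omega>. W (real (Suc i) * h) \<omega> - W (real i * h) \<omega>) = gauss h"
      by (simp add: gauss_def algebra_simps)
  qed
  finally show "distr M (Pi\<^sub>M {..<n} (\<lambda>_. borel)) ?D = Pi\<^sub>M {..<n} (\<lambda>_. gauss h)" .
qed

section \<open>Probability that Brownian motion stays in a tube around a line\<close>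

text \<open>One step of the walk applied to \<open>bump\<close>, with \<open>s\<close> for
  \<open>K * z\<^sup>2\<close> and \<open>r\<close> for \<open>K * h\<close>. To first order in
  \<open>r\<close> the claim is \<open>2 * exp (- 1) \<le> exp (- s) * (1 + 2 * s)\<close>, which
  has slack on all of \<open>[0,1]\<close>; lowering the coefficient of \<open>s\<close> to
  \<open>7/5\<close> pays for the higher orders.\<close>

lemma bump_step_inequality:
  fixes r s :: real
  assumes r: "0 < r" "r \<le> 1/8" and s: "0 \<le> s" "s \<le> 1"
  shows "(1 - 2 * r) * (exp (- s) - exp (- 1)) + exp (- 1)
    \<le> exp (- s + 2 * s * r / (1 + 2 * r)) / sqrt (1 + 2 * r)"
proof -
  have "(1 - r)\<^sup>2 * (1 + 2 * r) = 1 - r\<^sup>2 * (3 - 2 * r)" by (simp add: power2_eq_square algebra_simps)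
  also have "\<dots> \<le> 1" using r by simp
  finally have "sqrt ((1 - r)\<^sup>2 * (1 + 2 * r)) \<le> 1" by simp
  then have "(1 - r) * sqrt (1 + 2 * r) \<le> 1" using r by (simp add: real_sqrt_mult)
  then have s1: "1 - r \<le> 1 / sqrt (1 + 2 * r)" using r by (simp add: field_simps)
  \<comment> \<open>For \<open>r \<le> 1/8\<close> the factor \<open>1 + 2 * r\<close> is at most
    \<open>5/4\<close>, and \<open>8/5\<close> is 2 divided by that. Multiplication by
    \<open>1 - r\<close> below costs at most another \<open>1/5\<close>, which leaves
    \<open>7/5\<close>.\<close>
  have "8/5 * s * r * (1 + 2 * r) \<le> 2 * s * r"
  proof -
    have "(s * r) * (8/5 * (1 + 2 * r)) \<le> (s * r) * 2"
      using r s by (intro mult_left_mono) auto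
    then show ?thesis by (simp add: algebra_simps)
  qed
  then have "8/5 * s * r \<le> 2 * s * r / (1 + 2 * r)" using r by (simp add: field_simps)
  moreover have "1 + 2 * s * r / (1 + 2 * r) \<le> exp (2 * s * r / (1 + 2 * r))" by (rule exp_ge_add_one_self)
  ultimately have s2: "1 + 8/5 * s * r \<le> exp (2 * s * r / (1 + 2 * r))" by linarith
  have "s * r * r \<le> s * r * (1/8)" using r s by (intro mult_left_mono) auto
  then have s3: "1 - r + 7/5 * s * r \<le> (1 - r) * (1 + 8/5 * s * r)"
    by (simp add: algebra_simps)
  have s4: "1 - r + 7/5 * s * r \<le> exp (2 * s * r / (1 + 2 * r)) / sqrt (1 + 2 * r)"
  proof -
    have "(1 - r) * (1 + 8/5 * s * r) \<le> (1 / sqrt (1 + 2 * r)) * exp (2 * s * r / (1 + 2 * r))"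
      using s1 s2 r s by (intro mult_mono) auto
    with s3 show ?thesis by simp
  qed
  have br: "0 \<le> r + 7/5 * s * r" using r s by simp
  \<comment> \<open>Bounding \<open>exp (1 - s)\<close> from below by its tangent
    \<open>2 - s\<close> leaves \<open>9/5 * s - 7/5 * (s * s)\<close>, which is nonnegative on
    \<open>[0,1]\<close>.\<close>
  have "exp (- 1) * (2 * r) \<le> exp (- s) * (r + 7/5 * s * r)"
  proof -
    have "1 + (1 - s) \<le> exp (1 - s)" by (rule exp_ge_add_one_self)
    then have "(2 - s) * (r + 7/5 * s * r) \<le> exp (1 - s) * (r + 7/5 * s * r)"
      using br by (intro mult_right_mono) auto
    moreover have "2 * r \<le> (2 - s) * (r + 7/5 * s * r)"
    proof -
      have "s * s \<le> s * 1" using s by (intro mult_left_mono) auto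
      then have "0 \<le> r * (9/5 * s - 7/5 * (s * s))" using r s by (intro mult_nonneg_nonneg) auto
      then show ?thesis by (simp add: algebra_simps)
    qed
    ultimately have "exp (- 1) * (2 * r) \<le> exp (- 1) * (exp (1 - s) * (r + 7/5 * s * r))"
      by (intro mult_left_mono) auto
    also have "\<dots> = exp (- 1 + (1 - s)) * (r + 7/5 * s * r)" by (simp only: exp_add mult.assoc)
    finally show ?thesis by simp
  qed
  moreover have "(1 - 2 * r) * (exp (- s) - exp (- 1)) + exp (- 1)
    = exp (- s) * (1 - r + 7/5 * s * r) - exp (- s) * (r + 7/5 * s * r) + exp (- 1) * (2 * r)"
    by (simp add: algebra_simps)
  moreover have "exp (- s) * (1 - r + 7/5 * s * r) \<le> exp (- s) * (exp (2 * s * r / (1 + 2 * r)) / sqrt (1 + 2 * r))"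
    using s4 by (intro mult_left_mono) auto
  moreover have "exp (- s) * (exp (2 * s * r / (1 + 2 * r)) / sqrt (1 + 2 * r))
    = exp (- s + 2 * s * r / (1 + 2 * r)) / sqrt (1 + 2 * r)"
    by (simp only: exp_add times_divide_eq_right)
  ultimately show ?thesis by linarith
qed

text \<open>
  Positive for \<open>K z\<^sup>2 < 1\<close> and negative for \<open>K z\<^sup>2 > 1\<close>, hence a candidate subsolution for the walk killed
  outside the tube; the tilt \<open>exp (k z)\<close> absorbs the drift \<open>- k\<close> at the exact cost \<open>k\<^sup>2 h / 2\<close> per step.
\<close>

definition bump :: "real \<Rightarrow> real \<Rightarrow> real \<Rightarrow> real" where
  "bump k K z = exp (k * z) * (exp (- K * z\<^sup>2) - exp (- 1))"

text \<open>Outside the tube \<open>bump\<close> is negative and \<open>ennreal\<close> cuts it to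
  0, which only enlarges the right-hand side; this is why the estimate survives killing. The factor
  \<open>exp (- k\<^sup>2 * h / 2)\<close> is exact, only \<open>1 - 2 * (K * h)\<close> stems from
  an inequality.\<close>

lemma bump_step:
  assumes K: "0 < K" and h: "0 < h" and r: "K * h \<le> 1/8" and z: "K * z\<^sup>2 \<le> 1"
  shows "ennreal (exp (- k\<^sup>2 * h / 2) * (1 - 2 * (K * h)) * bump k K z)
     \<le> (\<integral>\<^sup>+y. ennreal (bump k K (z + y - k * h)) \<partial>gauss h)"
proof -
  define s where "s = z - k * h"
  define b where "b = k - 2 * K * s"
  define E where "E = exp (k * z - k\<^sup>2 * h / 2)"
  have Kh: "0 < K * h" using K h by simp
  have p1: "1 - (- 2 * K) * h = 1 + 2 * (K * h)" by simp
  have "(\<integral>\<^sup>+y. ennreal (exp (k * (z + y - k * h) - K * (z + y - k * h)\<^sup>2)) \<partial>gauss h)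
     = (\<integral>\<^sup>+y. ennreal (exp (k * s - K * s\<^sup>2)) * ennreal (exp (b * y + (- 2 * K) / 2 * y\<^sup>2)) \<partial>gauss h)"
    by (intro nn_integral_cong)
       (simp add: s_def b_def power2_eq_square algebra_simps flip: ennreal_mult' exp_add)
  also have "\<dots> = ennreal (exp (k * s - K * s\<^sup>2)) * ennreal (exp (b\<^sup>2 * h / (2 * (1 + 2 * (K * h)))) / sqrt (1 + 2 * (K * h)))"
    using h Kh by (subst nn_integral_cmult) (simp_all only: nn_integral_gauss_exp_quadratic p1, auto)
  also have "\<dots> = ennreal (E * (exp (- (K * z\<^sup>2) + 2 * (K * z\<^sup>2) * (K * h) / (1 + 2 * (K * h))) / sqrt (1 + 2 * (K * h))))"
  proof -
    have b: "b = k * (1 + 2 * (K * h)) - 2 * K * z" by (simp add: b_def s_def algebra_simps)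
    have "b\<^sup>2 * h / (2 * (1 + 2 * (K * h))) = k\<^sup>2 * (1 + 2 * (K * h)) * h / 2 - 2 * k * K * z * h
        + 2 * K\<^sup>2 * z\<^sup>2 * h / (1 + 2 * (K * h))"
      using Kh unfolding b by (simp add: divide_simps) (simp add: power2_eq_square algebra_simps)
    then have "k * s - K * s\<^sup>2 + b\<^sup>2 * h / (2 * (1 + 2 * (K * h)))
       = k * z - k\<^sup>2 * h / 2 + (- (K * z\<^sup>2) + 2 * (K * z\<^sup>2) * (K * h) / (1 + 2 * (K * h)))"
      by (simp add: s_def power2_eq_square algebra_simps add_divide_distrib diff_divide_distrib)
    then have "exp (k * s - K * s\<^sup>2) * exp (b\<^sup>2 * h / (2 * (1 + 2 * (K * h))))
      = E * exp (- (K * z\<^sup>2) + 2 * (K * z\<^sup>2) * (K * h) / (1 + 2 * (K * h)))"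
      unfolding E_def by (simp only: exp_add[symmetric])
    then show ?thesis by (simp flip: ennreal_mult')
  qed
  finally have I1: "(\<integral>\<^sup>+y. ennreal (exp (k * (z + y - k * h) - K * (z + y - k * h)\<^sup>2)) \<partial>gauss h)
    = ennreal (E * (exp (- (K * z\<^sup>2) + 2 * (K * z\<^sup>2) * (K * h) / (1 + 2 * (K * h))) / sqrt (1 + 2 * (K * h))))" .
  have "(\<integral>\<^sup>+y. ennreal (exp (k * (z + y - k * h) - 1)) \<partial>gauss h)
     = (\<integral>\<^sup>+y. ennreal (exp (k * s - 1)) * ennreal (exp (k * y + 0 / 2 * y\<^sup>2)) \<partial>gauss h)"
    by (intro nn_integral_cong)
       (simp add: s_def algebra_simps flip: ennreal_mult' exp_add)
  also have "\<dots> = ennreal (exp (k * s - 1)) * ennreal (exp (k\<^sup>2 * h / (2 * (1 - 0 * h))) / sqrt (1 - 0 * h))"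
    using h by (subst nn_integral_cmult) (simp_all only: nn_integral_gauss_exp_quadratic, auto)
  also have "\<dots> = ennreal (E * exp (- 1))"
    by (simp add: E_def s_def power2_eq_square algebra_simps flip: ennreal_mult' exp_add)
  finally have I2: "(\<integral>\<^sup>+y. ennreal (exp (k * (z + y - k * h) - 1)) \<partial>gauss h) = ennreal (E * exp (- 1))" .
  \<comment> \<open>Subtraction is awkward for extended nonnegative values, so the
    \<open>exp (- 1)\<close> part of \<open>bump\<close> is added on both sides and cancelled at the
    end.\<close>
  have "ennreal (E * (exp (- (K * z\<^sup>2) + 2 * (K * z\<^sup>2) * (K * h) / (1 + 2 * (K * h))) / sqrt (1 + 2 * (K * h))))
    \<le> (\<integral>\<^sup>+y. ennreal (bump k K (z + y - k * h)) + ennreal (exp (k * (z + y - k * h) - 1)) \<partial>gauss h)"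
    unfolding I1[symmetric]
  proof (intro nn_integral_mono)
    fix y
    define w where "w = z + y - k * h"
    have "exp (k * w - K * w\<^sup>2) = bump k K w + exp (k * w - 1)"
      by (simp add: bump_def algebra_simps flip: exp_add)
    then have "ennreal (exp (k * w - K * w\<^sup>2)) \<le> ennreal (max 0 (bump k K w) + exp (k * w - 1))"
      by (intro ennreal_leI) auto
    also have "\<dots> = ennreal (bump k K w) + ennreal (exp (k * w - 1))"
      by (simp add: max_def ennreal_neg)
    finally show "ennreal (exp (k * (z + y - k * h) - K * (z + y - k * h)\<^sup>2))
      \<le> ennreal (bump k K (z + y - k * h)) + ennreal (exp (k * (z + y - k * h) - 1))" by (simp add: w_def)
  qed
  also have "\<dots> = (\<integral>\<^sup>+y. ennreal (bump k K (z + y - k * h)) \<partial>gauss h) + ennreal (E * exp (- 1))"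
    unfolding I2[symmetric] bump_def by (intro nn_integral_add) auto
  finally have I3: "ennreal (E * (exp (- (K * z\<^sup>2) + 2 * (K * z\<^sup>2) * (K * h) / (1 + 2 * (K * h))) / sqrt (1 + 2 * (K * h))))
    \<le> (\<integral>\<^sup>+y. ennreal (bump k K (z + y - k * h)) \<partial>gauss h) + ennreal (E * exp (- 1))" .
  have zK: "0 \<le> K * z\<^sup>2" using K by simp
  have b0: "0 \<le> exp (- (K * z\<^sup>2)) - exp (- 1)" using z by simp
  have "ennreal (E * ((1 - 2 * (K * h)) * (exp (- (K * z\<^sup>2)) - exp (- 1)))) + ennreal (E * exp (- 1))
    = ennreal (E * ((1 - 2 * (K * h)) * (exp (- (K * z\<^sup>2)) - exp (- 1)) + exp (- 1)))"
    unfolding distrib_left using r b0 by (intro ennreal_plus[symmetric]) (auto simp: E_def)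
  also have "\<dots> \<le> ennreal (E * (exp (- (K * z\<^sup>2) + 2 * (K * z\<^sup>2) * (K * h) / (1 + 2 * (K * h))) / sqrt (1 + 2 * (K * h))))"
    using bump_step_inequality[OF Kh r zK z] by (intro ennreal_leI mult_left_mono) (auto simp: E_def)
  also note I3
  finally have "ennreal (E * ((1 - 2 * (K * h)) * (exp (- (K * z\<^sup>2)) - exp (- 1))))
    \<le> (\<integral>\<^sup>+y. ennreal (bump k K (z + y - k * h)) \<partial>gauss h)"
    by (simp add: ennreal_add_left_cancel_le add.commute[of _ "ennreal (E * exp (- 1))"])
  moreover have "E = exp (k * z) * exp (- k\<^sup>2 * h / 2)" by (simp add: E_def flip: exp_add)
  then have "E * ((1 - 2 * (K * h)) * (exp (- (K * z\<^sup>2)) - exp (- 1)))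
    = exp (- k\<^sup>2 * h / 2) * (1 - 2 * (K * h)) * bump k K z"
    by (simp add: bump_def)
  ultimately show ?thesis by simp
qed

text \<open>Sub-eigenfunction argument: every step of the killed walk multiplies the mean of
  \<open>bump\<close> by at least the base of the \<open>n\<close>-th power. This mean starts at
  \<open>1 - exp (- 1)\<close>, the value at 0, and is at most
  \<open>exp (\<bar>k\<bar> * d)\<close> times the survival probability.\<close>

lemma chain_tube_prob_ge:
  fixes d h k :: real
  assumes d: "0 < d" and h: "0 < h" and r: "h / d\<^sup>2 \<le> 1/8"
  defines "N \<equiv> gauss h" and "st \<equiv> (\<lambda>z y. z + y - k * h)"
  shows "ennreal ((exp (- k\<^sup>2 * h / 2) * (1 - 2 * (h / d\<^sup>2))) ^ n * (1 - exp (- 1)))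
   \<le> ennreal (exp (\<bar>k\<bar> * d)) *
     emeasure (Pi\<^sub>M {..<n} (\<lambda>_. N)) {v \<in> space (Pi\<^sub>M {..<n} (\<lambda>_. N)). \<forall>i<n. \<bar>chain 0 st v (Suc i)\<bar> \<le> d}"
proof -
  \<comment> \<open>Puts the zeros of \<open>bump\<close> exactly on the walls
    \<open>\<bar>z\<bar> = d\<close>.\<close>
  define K where "K = 1 / d\<^sup>2"
  have K: "K > 0" using d by (simp add: K_def)
  have Kz: "K * z\<^sup>2 \<le> 1 \<longleftrightarrow> \<bar>z\<bar> \<le> d" for z
    using d abs_le_square_iff[of z d] by (simp add: K_def)
  define rho where "rho = exp (- k\<^sup>2 * h / 2) * (1 - 2 * (K * h))"
  have rr: "K * h \<le> 1/8" using r by (simp add: K_def)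
  have rho: "rho \<ge> 0" using rr by (simp add: rho_def)
  define ph where "ph = (\<lambda>z y. indicator {-d..d} (st z y) :: ennreal)"
  define ps where "ps = (\<lambda>z. ennreal (bump k K z))"
  have st_m[measurable]: "case_prod st \<in> borel_measurable (borel \<Otimes>\<^sub>M borel)" unfolding st_def by measurable
  have ph_m[measurable]: "case_prod ph \<in> borel_measurable (borel \<Otimes>\<^sub>M borel)"
    unfolding ph_def st_def by measurable
  have ps_m[measurable]: "ps \<in> borel_measurable borel" unfolding ps_def bump_def by measurable
  have sN: "sets N = sets borel" and pN: "prob_space N" using h by (auto simp: N_def prob_space_gauss)
  have ps0: "ps z = 0" if "\<not> \<bar>z\<bar> \<le> d" for z
  proof -
    have "K * z\<^sup>2 \<ge> 1" using that Kz[of z] by simp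
    then have "bump k K z \<le> 0" unfolding bump_def by (intro mult_nonneg_nonpos) auto
    then show ?thesis by (simp add: ps_def ennreal_neg)
  qed
  \<comment> \<open>Killing costs nothing, since \<open>ps\<close> already vanishes outside the
    tube.\<close>
  have phps: "ph z y * ps (st z y) = ps (st z y)" for z y
    using ps0[of "st z y"] by (auto simp: ph_def split: split_indicator)
  have step: "ennreal rho * ps z \<le> (\<integral>\<^sup>+y. ph z y * ps (st z y) \<partial>N)" for z
  proof (cases "\<bar>z\<bar> \<le> d")
    case True
    have "ennreal rho * ps z = ennreal (rho * bump k K z)"
      using rho by (simp add: ps_def ennreal_mult')
    also have "\<dots> \<le> (\<integral>\<^sup>+y. ennreal (bump k K (z + y - k * h)) \<partial>gauss h)"
      unfolding rho_def using bump_step[OF K h rr, of z k] True Kz by simp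
    finally show ?thesis unfolding phps by (simp add: ps_def N_def st_def)
  qed (simp add: ps0)
  define J where "J = (\<lambda>n. \<integral>\<^sup>+v. path_weight 0 st ph n v * ps (chain 0 st v n) \<partial>Pi\<^sub>M {..<n} (\<lambda>_. N))"
  have J: "ennreal (rho ^ n * (1 - exp (- 1))) \<le> J n" for n
  proof (induction n)
    case 0
    show ?case by (simp add: J_def path_weight_def ps_def bump_def nn_integral_count_space_finite PiM_empty)
  next
    case (Suc n)
    have m: "path_weight 0 st ph n \<in> borel_measurable (Pi\<^sub>M {..<n} (\<lambda>_. N))"
      "(\<lambda>v. chain 0 st v n) \<in> borel_measurable (Pi\<^sub>M {..<n} (\<lambda>_. N))"
      by (intro measurable_path_weight measurable_chain st_m ph_m sN order_refl)+
    have "ennreal (rho ^ Suc n * (1 - exp (- 1))) = ennreal rho * ennreal (rho ^ n * (1 - exp (- 1)))"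
      using rho by (simp add: mult.assoc flip: ennreal_mult')
    also have "\<dots> \<le> ennreal rho * J n" by (intro mult_left_mono Suc) auto
    also have "\<dots> = (\<integral>\<^sup>+v. path_weight 0 st ph n v * (ennreal rho * ps (chain 0 st v n)) \<partial>Pi\<^sub>M {..<n} (\<lambda>_. N))"
      unfolding J_def using m by (subst nn_integral_cmult[symmetric]) (auto simp: ac_simps)
    also have "\<dots> \<le> (\<integral>\<^sup>+v. path_weight 0 st ph n v * (\<integral>\<^sup>+y. ph (chain 0 st v n) y * ps (st (chain 0 st v n) y) \<partial>N)
         \<partial>Pi\<^sub>M {..<n} (\<lambda>_. N))"
      by (intro nn_integral_mono mult_left_mono step) auto
    also have "\<dots> = J (Suc n)"
      unfolding J_def by (intro nn_integral_path_weight_Suc[symmetric] st_m ph_m ps_m sN pN)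
    finally show ?case .
  qed
  let ?A = "{v \<in> space (Pi\<^sub>M {..<n} (\<lambda>_. N)). \<forall>i<n. \<bar>chain 0 st v (Suc i)\<bar> \<le> d}"
  have Am: "?A \<in> sets (Pi\<^sub>M {..<n} (\<lambda>_. N))"
  proof -
    have "(\<lambda>v. chain 0 st v (Suc i)) \<in> borel_measurable (Pi\<^sub>M {..<n} (\<lambda>_. N))" if "i < n" for i
      using that by (intro measurable_chain st_m sN) auto
    then have "{v \<in> space (Pi\<^sub>M {..<n} (\<lambda>_. N)). \<bar>chain 0 st v (Suc i)\<bar> \<le> d} \<in> sets (Pi\<^sub>M {..<n} (\<lambda>_. N))"
      if "i \<in> {..<n}" for i
      using that by (intro borel_measurable_le borel_measurable_abs) auto
    then have "{v \<in> space (Pi\<^sub>M {..<n} (\<lambda>_. N)). \<forall>i\<in>{..<n}. \<bar>chain 0 st v (Suc i)\<bar> \<le> d} \<in> sets (Pi\<^sub>M {..<n} (\<lambda>_. N))"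
      by (rule sets.sets_Collect_finite_All) simp_all
    then show ?thesis by (simp only: lessThan_iff Ball_def)
  qed
  have "J n \<le> (\<integral>\<^sup>+v. ennreal (exp (\<bar>k\<bar> * d)) * indicator ?A v \<partial>Pi\<^sub>M {..<n} (\<lambda>_. N))"
    unfolding J_def
  proof (intro nn_integral_mono)
    fix v assume v: "v \<in> space (Pi\<^sub>M {..<n} (\<lambda>_. N))"
    show "path_weight 0 st ph n v * ps (chain 0 st v n) \<le> ennreal (exp (\<bar>k\<bar> * d)) * indicator ?A v"
    proof (cases "v \<in> ?A")
      case False
      then obtain i where i: "i < n" "\<not> \<bar>chain 0 st v (Suc i)\<bar> \<le> d" using v by auto
      then have "ph (chain 0 st v i) (v i) = 0" by (auto simp: ph_def split: split_indicator)
      then have "path_weight 0 st ph n v = 0" using i unfolding path_weight_def by (intro prod_zero) auto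
      then show ?thesis by simp
    next
      case True
      have p1: "path_weight 0 st ph n v \<le> 1"
        unfolding path_weight_def by (intro prod_le_1) (auto simp: ph_def split: split_indicator)
      let ?z = "chain 0 st v n"
      have "ps ?z \<le> ennreal (exp (\<bar>k\<bar> * d))"
      proof (cases "\<bar>?z\<bar> \<le> d")
        case True
        have "k * ?z \<le> \<bar>k\<bar> * \<bar>?z\<bar>" by (simp flip: abs_mult)
        also have "\<dots> \<le> \<bar>k\<bar> * d" using True by (intro mult_left_mono) auto
        finally have "k * ?z \<le> \<bar>k\<bar> * d" .
        moreover have "exp (- K * ?z\<^sup>2) - exp (- 1) \<le> 1"
        proof -
          have "exp (- K * ?z\<^sup>2) \<le> 1" using K by simp
          then show ?thesis using exp_gt_zero[of "-1::real"] by linarith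
        qed
        moreover have "0 \<le> exp (- K * ?z\<^sup>2) - exp (- 1)" using True Kz[of ?z] by simp
        ultimately have "bump k K ?z \<le> exp (\<bar>k\<bar> * d) * 1"
          unfolding bump_def by (intro mult_mono) auto
        then show ?thesis by (simp add: ps_def ennreal_leI)
      qed (simp add: ps0)
      then have "path_weight 0 st ph n v * ps ?z \<le> 1 * ennreal (exp (\<bar>k\<bar> * d))"
        using p1 by (intro mult_mono) auto
      then show ?thesis using True by simp
    qed
  qed
  also have "\<dots> = ennreal (exp (\<bar>k\<bar> * d)) * emeasure (Pi\<^sub>M {..<n} (\<lambda>_. N)) ?A"
    by (rule nn_integral_cmult_indicator[OF Am])
  finally have "ennreal (rho ^ n * (1 - exp (- 1))) \<le> ennreal (exp (\<bar>k\<bar> * d)) * emeasure (Pi\<^sub>M {..<n} (\<lambda>_. N)) ?A"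
    by (rule order_trans[OF J])
  moreover have "rho = exp (- k\<^sup>2 * h / 2) * (1 - 2 * (h / d\<^sup>2))" by (simp add: rho_def K_def)
  ultimately show ?thesis by (simp only:)
qed

text \<open>Turns the \<open>n\<close>-fold product of one-step factors into an exponential, at the
  price of the rate 2 becoming 4.\<close>

lemma one_minus_ge_exp:
  fixes r :: real
  assumes "0 \<le> r" "r \<le> 1/8"
  shows "exp (- (4 * r)) \<le> 1 - 2 * r"
proof -
  have "r * (8 * r) \<le> r * 2" using assms by (intro mult_left_mono) auto
  then have "1 \<le> (1 - 2 * r) * (1 + 4 * r)" by (simp add: algebra_simps)
  also have "\<dots> \<le> (1 - 2 * r) * exp (4 * r)"
    using assms exp_ge_add_one_self[of "4 * r"] by (intro mult_left_mono) auto
  finally show ?thesis by (simp add: exp_minus field_simps)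
qed

text \<open>The bound is free of \<open>n\<close>, so the grid can be refined. \<open>W 0\<close> is
  subtracted because the chain sums increments from 0, while \<open>W 0 = 0\<close> holds only
  almost surely.\<close>

lemma brownian_grid_tube_prob_ge:
  fixes d T k :: real
  assumes W: "standard_brownian_motion M W" and d: "0 < d" and T: "0 < T" and n: "0 < n"
    and r: "T / real n / d\<^sup>2 \<le> 1/8"
  defines "A \<equiv> {\<omega> \<in> space M. \<forall>i\<le>n. \<bar>W (real i * (T / real n)) \<omega> - W 0 \<omega> - k * (real i * (T / real n))\<bar> \<le> d}"
  shows "A \<in> sets M"
    and "exp (- k\<^sup>2 * T / 2 - 4 * T / d\<^sup>2 - \<bar>k\<bar> * d) * (1 - exp (- 1)) \<le> measure M A"
proof -
  define h where "h = T / real n"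
  have h: "0 < h" using T n by (simp add: h_def)
  have hr: "h / d\<^sup>2 \<le> 1/8" using r by (simp add: h_def)
  interpret prob_space M using W by (simp add: standard_brownian_motion_def)
  let ?st = "\<lambda>z y. z + y - k * h"
  define D where "D = (\<lambda>\<omega>. \<lambda>i\<in>{..<n}. W (real (Suc i) * h) \<omega> - W (real i * h) \<omega>)"
  note D = standard_brownian_motion_increments[OF W h, of n, folded D_def]
  let ?B = "{v \<in> space (Pi\<^sub>M {..<n} (\<lambda>_. gauss h)). \<forall>i<n. \<bar>chain 0 ?st v (Suc i)\<bar> \<le> d}"
  have sp: "sets (Pi\<^sub>M {..<n} (\<lambda>_. gauss h)) = sets (Pi\<^sub>M {..<n} (\<lambda>_. borel))"
    by (intro sets_PiM_cong) auto
  have B: "?B \<in> sets (Pi\<^sub>M {..<n} (\<lambda>_. borel))"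
  proof -
    have "(\<lambda>v. chain 0 ?st v (Suc i)) \<in> borel_measurable (Pi\<^sub>M {..<n} (\<lambda>_. gauss h))" if "i < n" for i
      using that by (intro measurable_chain sets_gauss) auto
    then have "{v \<in> space (Pi\<^sub>M {..<n} (\<lambda>_. gauss h)). \<bar>chain 0 ?st v (Suc i)\<bar> \<le> d} \<in> sets (Pi\<^sub>M {..<n} (\<lambda>_. gauss h))"
      if "i \<in> {..<n}" for i
      using that by (intro borel_measurable_le borel_measurable_abs) auto
    then have "{v \<in> space (Pi\<^sub>M {..<n} (\<lambda>_. gauss h)). \<forall>i\<in>{..<n}. \<bar>chain 0 ?st v (Suc i)\<bar> \<le> d} \<in> sets (Pi\<^sub>M {..<n} (\<lambda>_. gauss h))"
      by (rule sets.sets_Collect_finite_All) simp_all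
    then show ?thesis unfolding sp by (simp only: lessThan_iff Ball_def)
  qed
  have ch: "chain 0 ?st (D \<omega>) i = W (real i * h) \<omega> - W 0 \<omega> - k * (real i * h)" if "i \<le> n" for i \<omega>
    using that by (induction i) (auto simp: D_def algebra_simps)
  have Aeq: "A = D -` ?B \<inter> space M"
  proof -
    have "D \<omega> \<in> space (Pi\<^sub>M {..<n} (\<lambda>_. gauss h))" for \<omega> by (simp add: D_def space_PiM)
    moreover have "(\<forall>i\<le>n. \<bar>W (real i * h) \<omega> - W 0 \<omega> - k * (real i * h)\<bar> \<le> d)
      \<longleftrightarrow> (\<forall>i<n. \<bar>chain 0 ?st (D \<omega>) (Suc i)\<bar> \<le> d)" for \<omega>
    proof safe
      fix i assume *: "\<forall>i\<le>n. \<bar>W (real i * h) \<omega> - W 0 \<omega> - k * (real i * h)\<bar> \<le> d" and i: "i < n"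
      show "\<bar>chain 0 ?st (D \<omega>) (Suc i)\<bar> \<le> d"
        unfolding ch[OF Suc_leI[OF i]] using * i by (metis Suc_leI)
    next
      fix i assume *: "\<forall>i<n. \<bar>chain 0 ?st (D \<omega>) (Suc i)\<bar> \<le> d" and i: "i \<le> n"
      show "\<bar>W (real i * h) \<omega> - W 0 \<omega> - k * (real i * h)\<bar> \<le> d"
      proof (cases i)
        case (Suc j)
        then have "\<bar>chain 0 ?st (D \<omega>) (Suc j)\<bar> \<le> d" using * i by auto
        then show ?thesis using ch[OF i, of \<omega>] Suc by simp
      qed (use d in simp)
    qed
    ultimately show ?thesis unfolding A_def h_def[symmetric] by blast
  qed
  then show "A \<in> sets M" using measurable_sets[OF D(1) B] by simp
  have "emeasure M A = emeasure (distr M (Pi\<^sub>M {..<n} (\<lambda>_. borel)) D) ?B"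
    unfolding Aeq by (rule emeasure_distr[OF D(1) B, symmetric])
  also have "\<dots> = emeasure (Pi\<^sub>M {..<n} (\<lambda>_. gauss h)) ?B" by (simp only: D(2)[OF n])
  finally have eA: "emeasure M A = emeasure (Pi\<^sub>M {..<n} (\<lambda>_. gauss h)) ?B" .
  have "ennreal ((exp (- k\<^sup>2 * h / 2) * (1 - 2 * (h / d\<^sup>2))) ^ n * (1 - exp (- 1)))
    \<le> ennreal (exp (\<bar>k\<bar> * d)) * emeasure M A"
    unfolding eA by (rule chain_tube_prob_ge[OF d h hr])
  then have le: "(exp (- k\<^sup>2 * h / 2) * (1 - 2 * (h / d\<^sup>2))) ^ n * (1 - exp (- 1))
    \<le> exp (\<bar>k\<bar> * d) * measure M A"
    unfolding emeasure_eq_measure by (simp flip: ennreal_mult')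
  have "exp (- k\<^sup>2 * T / 2 - 4 * T / d\<^sup>2) = exp (- k\<^sup>2 * h / 2 - 4 * (h / d\<^sup>2)) ^ n"
  proof -
    have "real n * (- k\<^sup>2 * h / 2 - 4 * (h / d\<^sup>2)) = - k\<^sup>2 * T / 2 - 4 * T / d\<^sup>2"
      using n d by (simp add: h_def field_simps)
    then show ?thesis by (metis exp_of_nat_mult)
  qed
  also have "\<dots> \<le> (exp (- k\<^sup>2 * h / 2) * (1 - 2 * (h / d\<^sup>2))) ^ n"
  proof (intro power_mono)
    have "exp (- k\<^sup>2 * h / 2 - 4 * (h / d\<^sup>2)) = exp (- k\<^sup>2 * h / 2) * exp (- (4 * (h / d\<^sup>2)))"
      by (simp flip: exp_add)
    also have "\<dots> \<le> exp (- k\<^sup>2 * h / 2) * (1 - 2 * (h / d\<^sup>2))"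
      using h hr by (intro mult_left_mono one_minus_ge_exp) auto
    finally show "exp (- k\<^sup>2 * h / 2 - 4 * (h / d\<^sup>2)) \<le> exp (- k\<^sup>2 * h / 2) * (1 - 2 * (h / d\<^sup>2))" .
  qed simp
  finally have "exp (- k\<^sup>2 * T / 2 - 4 * T / d\<^sup>2) * (1 - exp (- 1)) \<le> exp (\<bar>k\<bar> * d) * measure M A"
    using le by (meson mult_right_mono diff_ge_0_iff_ge exp_le_one_iff order_trans neg_le_0_iff_le zero_le_one)
  then have "exp (- (\<bar>k\<bar> * d)) * (exp (- k\<^sup>2 * T / 2 - 4 * T / d\<^sup>2) * (1 - exp (- 1)))
    \<le> exp (- (\<bar>k\<bar> * d)) * (exp (\<bar>k\<bar> * d) * measure M A)"
    by (intro mult_left_mono) auto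
  also have "\<dots> = measure M A" by (simp add: exp_minus)
  finally show "exp (- k\<^sup>2 * T / 2 - 4 * T / d\<^sup>2 - \<bar>k\<bar> * d) * (1 - exp (- 1)) \<le> measure M A"
    by (simp only: mult.assoc[symmetric] exp_add[symmetric] uminus_add_conv_diff)
qed

text \<open>Dyadic grids are nested, so their tube events decrease and continuity of the measure
  from above keeps the bound. The witness \<open>A\<close> is their countable intersection, hence
  measurable; path continuity then extends the tube to all times.\<close>

lemma brownian_tube_prob_ge:
  fixes d T k :: real
  assumes W: "standard_brownian_motion M W" and d: "0 < d" and T: "0 < T"
  obtains A where "A \<in> sets M" "AE \<omega> in M. \<omega> \<in> A \<longrightarrow> (\<forall>t\<in>{0..T}. \<bar>W t \<omega> - k * t\<bar> \<le> d)"
    "exp (- k\<^sup>2 * T / 2 - 4 * T / d\<^sup>2 - \<bar>k\<bar> * d) * (1 - exp (- 1)) \<le> measure M A"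
proof -
  interpret prob_space M using W by (simp add: standard_brownian_motion_def)
  define B where "B n = {\<omega> \<in> space M. \<forall>i\<le>n. \<bar>W (real i * (T / real n)) \<omega> - W 0 \<omega> - k * (real i * (T / real n))\<bar> \<le> d}" for n :: nat
  have "(\<lambda>m. T / real (2 ^ m) / d\<^sup>2) \<longlonglongrightarrow> 0"
    using LIMSEQ_divide_realpow_zero[of 2 "T / d\<^sup>2"] by (simp add: field_simps)
  then have "eventually (\<lambda>m. T / real (2 ^ m) / d\<^sup>2 < 1/8) sequentially"
    by (rule order_tendstoD) simp
  \<comment> \<open>Levels below \<open>m0\<close> may violate the mesh condition, so the sequence
    of grids starts there.\<close>
  then obtain m0 where m0: "\<And>m. m \<ge> m0 \<Longrightarrow> T / real (2 ^ m) / d\<^sup>2 \<le> 1/8"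
    unfolding eventually_sequentially by force
  define C where "C m = B (2 ^ (m + m0))" for m
  have Cs: "C m \<in> sets M" for m
    unfolding C_def B_def using m0[of "m + m0"]
    by (intro brownian_grid_tube_prob_ge(1)[OF W d T]) (simp_all only: zero_less_power zero_less_numeral le_add2)
  have quad_bound: "exp (- k\<^sup>2 * T / 2 - 4 * T / d\<^sup>2 - \<bar>k\<bar> * d) * (1 - exp (- 1)) \<le> measure M (C m)" for m
    unfolding C_def B_def using m0[of "m + m0"]
    by (intro brownian_grid_tube_prob_ge(2)[OF W d T]) (simp_all only: zero_less_power zero_less_numeral le_add2)
  have dec: "decseq C"
  proof (rule decseq_SucI)
    fix m
    show "C (Suc m) \<le> C m"
    proof
      fix \<omega> assume "\<omega> \<in> C (Suc m)"
      then have sp: "\<omega> \<in> space M" and *: "\<And>i. i \<le> 2 ^ (Suc m + m0) \<Longrightarrow>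
          \<bar>W (real i * (T / real (2 ^ (Suc m + m0)))) \<omega> - W 0 \<omega> - k * (real i * (T / real (2 ^ (Suc m + m0))))\<bar> \<le> d"
        by (auto simp: C_def B_def)
      have "\<bar>W (real i * (T / real (2 ^ (m + m0)))) \<omega> - W 0 \<omega> - k * (real i * (T / real (2 ^ (m + m0))))\<bar> \<le> d"
        if "i \<le> 2 ^ (m + m0)" for i
        using *[of "2 * i"] that by simp
      then show "\<omega> \<in> C m" using sp by (simp add: C_def B_def)
    qed
  qed
  have "(\<lambda>m. measure M (C m)) \<longlonglongrightarrow> measure M (\<Inter>m. C m)"
    using Cs dec by (intro finite_Lim_measure_decseq) auto
  then have 1: "exp (- k\<^sup>2 * T / 2 - 4 * T / d\<^sup>2 - \<bar>k\<bar> * d) * (1 - exp (- 1)) \<le> measure M (\<Inter>m. C m)"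
    using quad_bound by (intro LIMSEQ_le_const) auto
  have "AE \<omega> in M. W 0 \<omega> = 0" "AE \<omega> in M. continuous_on {0..} (\<lambda>t. W t \<omega>)"
    using W by (auto simp: standard_brownian_motion_def)
  then have 2: "AE \<omega> in M. \<omega> \<in> (\<Inter>m. C m) \<longrightarrow> (\<forall>t\<in>{0..T}. \<bar>W t \<omega> - k * t\<bar> \<le> d)"
  proof eventually_elim
    case (elim \<omega>)
    show ?case
    proof (intro impI ballI)
      fix t assume w: "\<omega> \<in> (\<Inter>m. C m)" and t: "t \<in> {0..T}"
      \<comment> \<open>\<open>s m\<close> is the last grid point not after \<open>t\<close>. It
        tends to \<open>t\<close> from below, and the closed bound passes to the limit.\<close>
      define i where "i m = nat \<lfloor>t / T * 2 ^ (m + m0)\<rfloor>" for m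
      define s where "s m = real (i m) * (T / 2 ^ (m + m0))" for m
      have tT: "0 \<le> t / T" "t / T \<le> 1" using t T by auto
      have ib: "real (i m) \<le> t / T * 2 ^ (m + m0)" "t / T * 2 ^ (m + m0) - 1 \<le> real (i m)" for m
      proof -
        have p: "0 \<le> t / T * 2 ^ (m + m0)" by (intro mult_nonneg_nonneg tT) simp
        show "real (i m) \<le> t / T * 2 ^ (m + m0)" unfolding i_def using p by (rule of_nat_floor)
        show "t / T * 2 ^ (m + m0) - 1 \<le> real (i m)" unfolding i_def by linarith
      qed
      have "real (i m) \<le> 2 ^ (m + m0)" for m
        using mult_right_mono[OF tT(2), of "2 ^ (m + m0)"]
        by (intro order_trans[OF ib(1)[of m]]) simp
      then have i2: "i m \<le> 2 ^ (m + m0)" for m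
        by (metis of_nat_le_iff of_nat_numeral of_nat_power)
      have sb: "s m \<le> t" "t - T / 2 ^ (m + m0) \<le> s m" "0 \<le> s m" for m
      proof -
        have "s m \<le> (t / T * 2 ^ (m + m0)) * (T / 2 ^ (m + m0))"
          unfolding s_def using ib T by (intro mult_right_mono) auto
        then show "s m \<le> t" using T by simp
        have "(t / T * 2 ^ (m + m0) - 1) * (T / 2 ^ (m + m0)) \<le> s m"
          unfolding s_def using ib T by (intro mult_right_mono) auto
        then show "t - T / 2 ^ (m + m0) \<le> s m" using T by (simp add: left_diff_distrib diff_divide_distrib)
        show "0 \<le> s m" using T by (simp add: s_def)
      qed
      have "(\<lambda>m. t - T / 2 ^ m) \<longlonglongrightarrow> t - 0"
        by (intro tendsto_intros LIMSEQ_divide_realpow_zero) auto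
      then have "(\<lambda>m. t - T / 2 ^ (m + m0)) \<longlonglongrightarrow> t"
        using LIMSEQ_ignore_initial_segment by fastforce
      then have lim: "s \<longlonglongrightarrow> t"
        by (rule tendsto_sandwich[rotated 2, OF _ tendsto_const]) (auto simp: sb)
      have "(\<lambda>m. W (s m) \<omega>) \<longlonglongrightarrow> W t \<omega>"
        using elim(2) lim t sb by (intro continuous_on_tendsto_compose[of "{0..}" "\<lambda>t. W t \<omega>"]) auto
      then have l2: "(\<lambda>m. \<bar>W (s m) \<omega> - k * s m\<bar>) \<longlonglongrightarrow> \<bar>W t \<omega> - k * t\<bar>"
        using lim by (intro tendsto_intros)
      have "\<bar>W (s m) \<omega> - k * s m\<bar> \<le> d" for m
      proof -
        have "\<omega> \<in> C m" using w by auto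
        then show ?thesis using i2[of m] elim(1) by (auto simp: C_def B_def s_def)
      qed
      then show "\<bar>W t \<omega> - k * t\<bar> \<le> d" by (intro LIMSEQ_le_const2[OF l2]) auto
    qed
  qed
  show thesis by (rule that[OF _ 2 1]) (use Cs in auto)
qed

section \<open>Explosion of the moment above the critical value\<close>

text \<open>If the claim fails at \<open>t\<close>, take the last time with \<open>f\<close> at or
  above \<open>c\<close>, or time 0 if there is none. From there to \<open>t\<close> the path is
  below \<open>c\<close>, yet the mean value theorem finds a slope smaller than
  \<open>m\<close>.\<close>

lemma rising_below_level:
  fixes f f' :: "real \<Rightarrow> real"
  assumes t: "0 \<le> t" and cont: "continuous_on {0..t} f"
    and der: "\<And>s. 0 < s \<Longrightarrow> s < t \<Longrightarrow> (f has_real_derivative f' s) (at s)"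
    and ge: "\<And>s. 0 < s \<Longrightarrow> s < t \<Longrightarrow> f s < c \<Longrightarrow> m \<le> f' s" and m: "0 \<le> m"
  shows "min c (f 0 + m * t) \<le> f t"
proof (rule ccontr)
  assume "\<not> min c (f 0 + m * t) \<le> f t"
  then have lt: "f t < c" "f t < f 0 + m * t" by auto
  define S where "S = {s \<in> {0..t}. c \<le> f s}"
  have above: False if r: "0 \<le> r" "r < t" and b: "\<And>s. r < s \<Longrightarrow> s < t \<Longrightarrow> f s < c" and fr: "f t < f r + m * (t - r)" for r
  proof -
    have "\<exists>l z. z > r \<and> z < t \<and> (f has_real_derivative l) (at z) \<and> f t - f r = (t - r) * l"
      using r der continuous_on_subset[OF cont, of "{r..t}"]
      by (intro MVT) (auto simp: real_differentiable_def intro: le_less_trans)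
    then obtain l z where z: "r < z" "z < t" "(f has_real_derivative l) (at z)" "f t - f r = (t - r) * l"
      by blast
    have z0: "0 < z" using z r by simp
    have "l = f' z" using DERIV_unique[OF z(3) der[OF z0 z(2)]] .
    then have "m \<le> l" using ge[OF z0 z(2)] b z by auto
    then have "(t - r) * m \<le> (t - r) * l" using r by (intro mult_left_mono) auto
    then show False using z fr by (simp add: algebra_simps)
  qed
  show False
  proof (cases "S = {}")
    case True
    have "t \<noteq> 0" using lt by auto
    then have "0 < t" using t by simp
    moreover have "f s < c" if "0 < s" "s < t" for s
    proof (rule ccontr)
      assume "\<not> f s < c"
      then have "s \<in> S" using that by (simp add: S_def)
      then show False using True by simp
    qed
    ultimately show False using above[of 0] lt by simp
  next
    case False
    have "compact S"
    proof -
      have "closed S" unfolding S_def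
        by (intro continuous_on_closed_Collect_le cont continuous_intros closed_atLeastAtMost)
      moreover have "S \<subseteq> {0..t}" by (auto simp: S_def)
      ultimately show ?thesis using compact_Icc[of 0 t] by (metis compact_Int_closed Int_absorb1)
    qed
    then obtain r where r: "r \<in> S" "\<And>s. s \<in> S \<Longrightarrow> s \<le> r"
      using compact_attains_sup[OF _ False] by blast
    have fr: "c \<le> f r" "0 \<le> r" "r \<le> t" using r by (auto simp: S_def)
    then have "r < t" using lt by (cases "r = t") auto
    moreover have "f s < c" if "r < s" "s < t" for s
    proof (rule ccontr)
      assume "\<not> f s < c"
      then have "s \<in> S" using that fr by (simp add: S_def)
      then show False using r(2)[of s] that by simp
    qed
    moreover have "0 \<le> m * (t - r)" using m \<open>r < t\<close> by simp
    then have "f t < f r + m * (t - r)" using fr lt by linarith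
    ultimately show False using above[of r] fr by blast
  qed
qed

lemma LINT_continuous_eq_integral:
  fixes g :: "real \<Rightarrow> real"
  assumes "continuous_on {a..b} g"
  shows "set_integrable lborel {a..b} g" "(LINT s:{a..b}|lborel. g s) = integral {a..b} g"
proof -
  show i: "set_integrable lborel {a..b} g" using assms by (rule borel_integrable_atLeastAtMost')
  show "(LINT s:{a..b}|lborel. g s) = integral {a..b} g" by (rule set_borel_integral_eq_integral(2)[OF i])
qed

text \<open>Replacing the noise by the line \<open>k * t\<close> gives a differentiable
  \<open>Z\<close> within \<open>sg * d\<close> of \<open>X\<close>. When \<open>Z\<close> is below
  \<open>R - sg * d\<close>, \<open>X\<close> is below \<open>R\<close>, where the decreasing drift
  leaves \<open>Z\<close> at least the upward speed \<open>m\<close>. The margin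
  \<open>sg * d\<close> is paid twice: from \<open>X\<close> to \<open>Z\<close> and back.\<close>

lemma solution_above_level:
  fixes X w lam :: "real \<Rightarrow> real"
  assumes cX: "continuous_on {0..T} X" and clam: "continuous_on UNIV lam" and anti: "antimono lam"
    and X: "\<And>t. 0 \<le> t \<Longrightarrow> t \<le> T \<Longrightarrow> X t = x + (LINT s:{0..t}|lborel. lam (X s)) + sg * w t"
    and w: "\<And>t. 0 \<le> t \<Longrightarrow> t \<le> T \<Longrightarrow> \<bar>w t - k * t\<bar> \<le> d"
    and sg: "0 < sg" and m: "0 < m" and R: "m \<le> lam R + sg * k"
    and t: "0 \<le> t" "t \<le> T" and tau: "R - x \<le> m * t" and d: "0 \<le> d"
  shows "R - 2 * sg * d \<le> X t"
proof -
  define Z where "Z s = x + integral {0..s} (\<lambda>u. lam (X u)) + sg * k * s" for s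
  have cl: "continuous_on {0..T} (\<lambda>u. lam (X u))"
    by (rule continuous_on_compose2[OF clam cX]) auto
  have XZ: "\<bar>X s - Z s\<bar> \<le> sg * d" if "0 \<le> s" "s \<le> T" for s
  proof -
    have "continuous_on {0..s} (\<lambda>u. lam (X u))" using cl that by (rule_tac continuous_on_subset) auto
    then have "X s - Z s = sg * (w s - k * s)"
      using X[OF that] LINT_continuous_eq_integral(2) by (simp add: Z_def algebra_simps)
    then show ?thesis using w[OF that] sg by (simp add: abs_mult)
  qed
  have der0: "((\<lambda>s. integral {0..s} (\<lambda>u. lam (X u))) has_vector_derivative lam (X s)) (at s within {0..T})"
    if "s \<in> {0..T}" for s
    using cl that by (rule integral_has_vector_derivative)
  have der: "(Z has_real_derivative (lam (X s) + sg * k)) (at s)" if s: "0 < s" "s < T" for s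
  proof -
    have "at s within {0..T} = at s" using s by (intro at_within_interior) auto
    then have "((\<lambda>s. integral {0..s} (\<lambda>u. lam (X u))) has_real_derivative lam (X s)) (at s)"
      using der0[of s] s by (simp add: has_real_derivative_iff_has_vector_derivative)
    then show ?thesis unfolding Z_def by (auto intro!: derivative_eq_intros)
  qed
  have cZ: "continuous_on {0..T} Z"
    unfolding Z_def
    by (intro continuous_intros indefinite_integral_continuous_1 integrable_continuous_real cl)
  have "min (R - sg * d) (Z 0 + m * t) \<le> Z t"
  proof (rule rising_below_level[where f' = "\<lambda>s. lam (X s) + sg * k"])
    show "continuous_on {0..t} Z" using cZ t by (rule_tac continuous_on_subset) auto
    show "(Z has_real_derivative lam (X s) + sg * k) (at s)" if "0 < s" "s < t" for s
      using der that t by auto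
    fix s assume s: "0 < s" "s < t" "Z s < R - sg * d"
    then have "X s \<le> R" using XZ[of s] t by auto
    then have "lam R \<le> lam (X s)" using anti by (auto dest: antimonoD)
    then show "m \<le> lam (X s) + sg * k" using R by simp
  qed (use m t in auto)
  moreover have "Z 0 + m * t \<ge> R" using tau by (simp add: Z_def)
  moreover have "0 \<le> sg * d" using sg d by simp
  ultimately have "R - sg * d \<le> Z t" by linarith
  then show ?thesis using XZ[OF t] by linarith
qed

section \<open>Analytic consequences of the drift classes\<close>

lemma class_D_has_deriv:
  assumes "lam \<in> class_D"
  shows "(lam has_real_derivative deriv lam y) (at y)" "continuous_on UNIV (deriv lam)"
proof -
  obtain D where D: "\<And>x. (lam has_vector_derivative D x) (at x)" "continuous_on UNIV D"
    using assms unfolding class_D_def C1_differentiable_on_def by auto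
  have 1: "(lam has_real_derivative D x) (at x)" for x
    using D(1) by (simp add: has_real_derivative_iff_has_vector_derivative)
  then have "deriv lam = D" by (auto intro: DERIV_imp_deriv)
  then show "(lam has_real_derivative deriv lam y) (at y)" "continuous_on UNIV (deriv lam)"
    using 1 D(2) by auto
qed

lemma class_D_continuous: "lam \<in> class_D \<Longrightarrow> continuous_on UNIV lam"
  by (meson DERIV_isCont class_D_has_deriv(1) continuous_at_imp_continuous_on)

lemma class_D_less: "lam \<in> class_D \<Longrightarrow> y < z \<Longrightarrow> lam z < lam y"
  by (auto simp: class_D_def monotone_on_def)

lemma class_D_antimono: "lam \<in> class_D \<Longrightarrow> antimono lam"
  by (metis antimonoI class_D_less less_eq_real_def)

lemma drift_dominated_bound:
  assumes "drift_dominated \<sigma> lam" "0 < e"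
  obtains b where "0 \<le> b" "\<And>y. b \<le> \<bar>y\<bar> \<Longrightarrow> \<sigma>\<^sup>2 * slope_q lam y / (lam y)\<^sup>2 < e"
proof -
  have "Limsup at_infinity (\<lambda>y. ereal (\<sigma>\<^sup>2 * slope_q lam y / (lam y)\<^sup>2)) < ereal e"
    using assms unfolding drift_dominated_def by simp
  then have "eventually (\<lambda>y. ereal (\<sigma>\<^sup>2 * slope_q lam y / (lam y)\<^sup>2) < ereal e) at_infinity"
    by (rule Limsup_lessD)
  then obtain b where "\<And>y. b \<le> \<bar>y\<bar> \<Longrightarrow> \<sigma>\<^sup>2 * slope_q lam y / (lam y)\<^sup>2 < e"
    by (auto simp: eventually_at_infinity)
  then show thesis by (intro that[of "max 0 b"]) auto
qed

lemma superlinear_bound: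
  assumes "superlinear lam" "lam \<in> class_D"
  obtains \<theta> where "lam \<theta> = 0" "\<And>K. eventually (\<lambda>y. K * (y - \<theta>) \<le> - lam y) at_top"
proof -
  obtain \<theta> where th: "lam \<theta> = 0"
    and f: "filterlim (\<lambda>y. \<bar>lam y\<bar> / \<bar>y - \<theta>\<bar>) at_top (filtercomap (\<lambda>y. \<bar>y - \<theta>\<bar>) at_top)"
    using assms by (auto simp: superlinear_def)
  have "eventually (\<lambda>y. K * (y - \<theta>) \<le> - lam y) at_top" for K
  proof -
    have "eventually (\<lambda>y. K \<le> \<bar>lam y\<bar> / \<bar>y - \<theta>\<bar>) (filtercomap (\<lambda>y. \<bar>y - \<theta>\<bar>) at_top)"
      using f by (simp add: filterlim_at_top)
    then obtain b where b: "\<And>y. b \<le> \<bar>y - \<theta>\<bar> \<Longrightarrow> K \<le> \<bar>lam y\<bar> / \<bar>y - \<theta>\<bar>"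
      by (auto simp: eventually_filtercomap eventually_at_top_linorder)
    show ?thesis
      using eventually_gt_at_top[of \<theta>] eventually_ge_at_top[of "\<theta> + b"]
    proof eventually_elim
      case (elim y)
      have "lam y < 0" using class_D_less[OF assms(2) elim(1)] th by simp
      then show ?case using b[of y] elim by (auto simp: field_simps)
    qed
  qed
  with th show thesis by (rule that)
qed

text \<open>Drift domination is a Lipschitz bound for \<open>1 / lam\<close>, whose derivative is
  \<open>slope_q lam y / (lam y)\<^sup>2\<close>.\<close>

lemma drift_dominated_nearby:
  assumes lam: "lam \<in> class_D" and sg: "0 < \<sigma>" and uR: "u \<le> R" and neg: "lam u < 0"
    and dom: "\<And>y. u \<le> y \<Longrightarrow> y \<le> R \<Longrightarrow> \<sigma>\<^sup>2 * slope_q lam y / (lam y)\<^sup>2 \<le> e"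
  shows "1 / lam R - 1 / lam u \<le> e / \<sigma>\<^sup>2 * (R - u)"
proof (cases "u = R")
  case False
  then have "u < R" using uR by simp
  have ng: "lam y < 0" if "u \<le> y" for y
    using class_D_less[OF lam, of u y] that neg by (cases "u = y") auto
  have der: "((\<lambda>y. 1 / lam y) has_real_derivative (slope_q lam y / (lam y)\<^sup>2)) (at y)" if "u \<le> y" for y
    using ng[OF that] unfolding slope_q_def
    by (auto intro!: derivative_eq_intros class_D_has_deriv[OF lam] simp: power2_eq_square)
  obtain z where z: "u < z" "z < R" "1 / lam R - 1 / lam u = (R - u) * (slope_q lam z / (lam z)\<^sup>2)"
    using MVT2[OF \<open>u < R\<close>, of "\<lambda>y. 1 / lam y" "\<lambda>y. slope_q lam y / (lam y)\<^sup>2"] der by blast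
  have "slope_q lam z / (lam z)\<^sup>2 \<le> e / \<sigma>\<^sup>2"
    using dom[of z] z sg by (simp add: field_simps)
  then have "(R - u) * (slope_q lam z / (lam z)\<^sup>2) \<le> (R - u) * (e / \<sigma>\<^sup>2)"
    using uR by (intro mult_left_mono) auto
  then show ?thesis using z by (simp add: mult.commute)
qed simp

text \<open>Supplies the plateau for the explosion: a level with strong drift that is cheap to reach
  from \<open>x\<close>, and a distance \<open>c / \<bar>lam R\<bar>\<close> below it over which the
  drift loses at most the fraction \<open>q\<close>.\<close>

lemma class_D_star_high_level:
  assumes lam: "lam \<in> class_D_star \<sigma>" and sg: "0 < \<sigma>" and p: "0 < p" and c: "0 < c" and q: "0 < q" "q < 1"
  obtains R where "lam R < 0" "B \<le> - lam R" "R - x \<le> p * (- lam R)"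
    "(1 - q) * (- lam R) \<le> - lam (R - c / (- lam R))"
proof -
  have D: "lam \<in> class_D" and sl: "superlinear lam" and dd: "drift_dominated \<sigma> lam"
    using lam by (auto simp: class_D_star_def)
  obtain \<theta> where th: "lam \<theta> = 0" and gr: "\<And>K. eventually (\<lambda>y. K * (y - \<theta>) \<le> - lam y) at_top"
    using superlinear_bound[OF sl D] by blast
  \<comment> \<open>Over the distance \<open>c / L\<close> the reciprocal \<open>1 / lam\<close>
    then moves by at most \<open>e / \<sigma>\<^sup>2 * (c / L) = q / L\<close>.\<close>
  define e where "e = q * \<sigma>\<^sup>2 / c"
  have e: "e > 0" using q sg c by (simp add: e_def)
  obtain b where b: "0 \<le> b" "\<And>y. b \<le> \<bar>y\<bar> \<Longrightarrow> \<sigma>\<^sup>2 * slope_q lam y / (lam y)\<^sup>2 < e"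
    using drift_dominated_bound[OF dd e] by blast
  have "eventually (\<lambda>R. lam R < 0 \<and> B \<le> - lam R \<and> R - x \<le> p * (- lam R) \<and>
    (1 - q) * (- lam R) \<le> - lam (R - c / (- lam R))) at_top"
    \<comment> \<open>The slope \<open>2 / p\<close> gives
      \<open>2 * (R - \<theta>) \<le> p * L\<close>, and \<open>2 * \<theta> - x \<le> R\<close>
      turns this into the bound for \<open>R - x\<close>. The two bounds with \<open>+ 1\<close>
      make room for \<open>u\<close>, which is at most 1 below \<open>R\<close> because
      \<open>c \<le> L\<close>.\<close>
    using gr[of 1] gr[of "2 / p"] eventually_gt_at_top[of "\<theta> + 1"] eventually_ge_at_top[of "b + 1"]
      eventually_ge_at_top[of "\<theta> + B"] eventually_ge_at_top[of "\<theta> + c"] eventually_ge_at_top[of "2 * \<theta> - x"]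
  proof eventually_elim
    case (elim R)
    define L where "L = - lam R"
    have neg: "lam R < 0" using class_D_less[OF D, of \<theta> R] th elim by simp
    have L: "B \<le> L" "c \<le> L" "0 < L" using elim neg by (auto simp: L_def)
    have "p * (2 / p * (R - \<theta>)) \<le> p * L"
      using elim p unfolding L_def by (intro mult_left_mono) auto
    then have px: "R - x \<le> p * L" using elim p by simp
    define u where "u = R - c / L"
    have cL: "0 \<le> c / L" "c / L \<le> 1" using L c by auto
    have u: "u \<le> R" "\<theta> < u" "b \<le> u" using cL elim by (auto simp: u_def)
    have negu: "lam u < 0" using class_D_less[OF D, of \<theta> u] th u by simp
    have "1 / lam R - 1 / lam u \<le> e / \<sigma>\<^sup>2 * (R - u)"
    proof (rule drift_dominated_nearby[OF D sg u(1) negu])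
      fix y assume "u \<le> y"
      then show "\<sigma>\<^sup>2 * slope_q lam y / (lam y)\<^sup>2 \<le> e"
        using b(2)[of y] b(1) u by auto
    qed
    also have "\<dots> = q / L" using sg c by (simp add: e_def u_def)
    finally have "1 / (- lam u) \<le> (1 + q) / L" by (simp add: L_def add_divide_distrib)
    then have "L \<le> (1 + q) * (- lam u)" using L negu by (simp add: field_simps)
    then have "(1 - q) * L \<le> (1 - q) * ((1 + q) * (- lam u))" using q by (intro mult_left_mono) auto
    also have "\<dots> = (1 - q\<^sup>2) * (- lam u)" by (simp add: power2_eq_square algebra_simps)
    also have "\<dots> \<le> 1 * (- lam u)" using negu by (intro mult_right_mono) auto
    finally have "(1 - q) * L \<le> - lam u" by simp
    then show ?case using neg L px unfolding u_def L_def by simp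
  qed
  then have "\<exists>R. lam R < 0 \<and> B \<le> - lam R \<and> R - x \<le> p * (- lam R) \<and>
    (1 - q) * (- lam R) \<le> - lam (R - c / (- lam R))"
    by (rule eventually_happens'[rotated]) simp
  then show thesis using that by blast
qed

text \<open>If the value were a finite \<open>r\<close>, the tube event alone would exceed it for
  large \<open>k\<close>. In the exponent the gain is \<open>(1/2 + 2 * g) * T * k\<^sup>2\<close>,
  the slope of the line costs \<open>T * k\<^sup>2 / 2\<close>, confinement
  \<open>g * T * k\<^sup>2\<close> and the tilt at the endpoint \<open>c0\<close>; what survives is
  \<open>g * T * k\<^sup>2 - c0\<close>.\<close>

lemma drift_exp_moment_infinite:
  assumes sg: "0 < \<sigma>" and lam: "lam \<in> class_D_star \<sigma>" and W: "standard_brownian_motion M W"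
    and X: "strong_solution M W lam \<sigma> x X" and a: "1/2 < a" and T: "0 < T"
  shows "drift_exp_moment M lam \<sigma> X a T = \<infinity>"
proof (rule ccontr)
  assume "drift_exp_moment M lam \<sigma> X a T \<noteq> \<infinity>"
  then obtain r where r: "0 \<le> r" "drift_exp_moment M lam \<sigma> X a T = ennreal r"
    by (cases "drift_exp_moment M lam \<sigma> X a T") auto
  interpret prob_space M using W by (simp add: standard_brownian_motion_def)
  have D: "lam \<in> class_D" using lam by (simp add: class_D_star_def)
  \<comment> \<open>Of the five factors \<open>1 - \<eta>\<close> below, one is the share of time
    left after the climb and four come from squaring
    \<open>(1 - \<eta>)\<^sup>2 * \<sigma> * k\<close>. By Bernoulli they use up at most half of the
    excess \<open>a - 1/2\<close>; the other half is \<open>2 * g\<close>.\<close>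
  define \<eta> where "\<eta> = (a - 1/2) / (10 * a)"
  have eta: "0 < \<eta>" "\<eta> < 1" using a by (auto simp: \<eta>_def field_simps)
  define g where "g = (a - 1/2) / 4"
  have g: "0 < g" using a by (simp add: g_def)
  have pow: "1/2 + 2 * g \<le> a * (1 - \<eta>) ^ 5"
  proof -
    have "1 + real 5 * (- \<eta>) \<le> (1 + (- \<eta>)) ^ 5"
      using eta by (intro Bernoulli_inequality) auto
    then have "a * (1 - 5 * \<eta>) \<le> a * (1 - \<eta>) ^ 5" using a by (intro mult_left_mono) auto
    moreover have "a * (1 - 5 * \<eta>) = 1/2 + 2 * g" using a by (simp add: \<eta>_def g_def field_simps)
    ultimately show ?thesis by simp
  qed
  define c0 where "c0 = sqrt (4 / g)"
  have c0: "0 < c0" "4 / c0\<^sup>2 = g" using g by (auto simp: c0_def)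
  define q where "q = 1 - exp (- 1 :: real)"
  have q: "0 < q" by (simp add: q_def)
  \<comment> \<open>Forces \<open>g * T * k - c0 \<ge> r / q\<close>, so that the surviving
    exponential exceeds \<open>r / q\<close>; \<open>k \<ge> 1\<close> allows passing from
    \<open>k\<close> to \<open>k\<^sup>2\<close>.\<close>
  define k0 where "k0 = max 1 ((r / q + c0) / (g * T))"
  have p: "0 < \<eta>\<^sup>2 * T / (1 - \<eta>)" and c: "0 < 2 * \<sigma>\<^sup>2 * c0 * (1 - \<eta>)"
    using eta T sg c0 by auto
  \<comment> \<open>The first coefficient lets a climb at speed \<open>\<eta> * \<sigma> * k\<close>
    reach \<open>R\<close> within time \<open>\<eta> * T\<close>. The distance in the last
    conclusion will be \<open>2 * \<sigma> * d\<close>, the dip that the tube permits.\<close>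
  obtain R where R: "lam R < 0" "(1 - \<eta>) * \<sigma> * k0 \<le> - lam R" "R - x \<le> \<eta>\<^sup>2 * T / (1 - \<eta>) * (- lam R)"
    "(1 - \<eta>) * (- lam R) \<le> - lam (R - (2 * \<sigma>\<^sup>2 * c0 * (1 - \<eta>)) / (- lam R))"
    using class_D_star_high_level[OF lam sg p c eta] by blast
  \<comment> \<open>The noise slope \<open>\<sigma> * k\<close> exceeds
    \<open>\<bar>lam R\<bar>\<close> by \<open>\<eta> * \<sigma> * k\<close>, the net upward speed
    at \<open>R\<close>.\<close>
  define k where "k = - lam R / ((1 - \<eta>) * \<sigma>)"
  have lamR: "- lam R = (1 - \<eta>) * \<sigma> * k" using eta sg by (simp add: k_def)
  have "(1 - \<eta>) * \<sigma> * k0 \<le> (1 - \<eta>) * \<sigma> * k" using R(2) lamR by simp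
  then have kk0: "k0 \<le> k" using eta sg by simp
  then have k: "1 \<le> k" "(r / q + c0) / (g * T) \<le> k" by (auto simp: k0_def)
  define d where "d = c0 / k"
  have d: "0 < d" using c0 k by (simp add: d_def)
  have sd: "2 * \<sigma>\<^sup>2 * c0 * (1 - \<eta>) / (- lam R) = 2 * \<sigma> * d"
    unfolding lamR d_def using eta sg k by (simp add: field_simps power2_eq_square)
  have lev: "(1 - \<eta>)\<^sup>2 * \<sigma> * k \<le> - lam (R - 2 * \<sigma> * d)"
  proof -
    have "(1 - \<eta>)\<^sup>2 * \<sigma> * k = (1 - \<eta>) * (- lam R)"
      unfolding lamR by (simp add: power2_eq_square mult.assoc)
    then show ?thesis using R(4)[unfolded sd] by (simp only:)
  qed
  obtain A where A: "A \<in> sets M" "AE \<omega> in M. \<omega> \<in> A \<longrightarrow> (\<forall>t\<in>{0..T}. \<bar>W t \<omega> - k * t\<bar> \<le> d)"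
    "exp (- k\<^sup>2 * T / 2 - 4 * T / d\<^sup>2 - \<bar>k\<bar> * d) * (1 - exp (- 1)) \<le> measure M A"
    using brownian_tube_prob_ge[OF W d T] by blast
  have Xc: "AE \<omega> in M. continuous_on {0..} (\<lambda>t. X t \<omega>)"
    and Xe: "AE \<omega> in M. \<forall>t\<ge>0. X t \<omega> = x + (LINT s:{0..t}|lborel. lam (X s \<omega>)) + \<sigma> * W t \<omega>"
    using X by (auto simp: strong_solution_def)
  have "AE \<omega> in M. ennreal (exp ((1/2 + 2 * g) * T * k\<^sup>2)) * indicator A \<omega>
    \<le> ennreal (exp (a * (LINT s:{0..T}|lborel. (lam (X s \<omega>))\<^sup>2 / \<sigma>\<^sup>2)))"
    using A(2) Xc Xe
  proof eventually_elim
    case (elim \<omega>)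
    show ?case
    proof (cases "\<omega> \<in> A")
      case True
      have cX: "continuous_on {0..T} (\<lambda>t. X t \<omega>)" using elim(2) by (rule continuous_on_subset) auto
      have up: "R - 2 * \<sigma> * d \<le> X t \<omega>" if "\<eta> * T \<le> t" "t \<le> T" for t
      proof (rule solution_above_level[OF cX class_D_continuous[OF D] class_D_antimono[OF D], where w = "\<lambda>t. W t \<omega>" and x = x and m = "\<eta> * \<sigma> * k" and k = k])
        show "\<eta> * \<sigma> * k \<le> lam R + \<sigma> * k" using lamR by (simp add: algebra_simps)
        have "\<eta> * \<sigma> * k * (\<eta> * T) \<le> \<eta> * \<sigma> * k * t"
          using that eta sg k by (intro mult_left_mono) auto
        moreover have "\<eta>\<^sup>2 * T / (1 - \<eta>) * (- lam R) = \<eta> * \<sigma> * k * (\<eta> * T)"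
          unfolding lamR using eta by (simp add: power2_eq_square)
        ultimately show "R - x \<le> \<eta> * \<sigma> * k * t" using R(3) by linarith
        show "0 \<le> t" using that eta T by (meson mult_nonneg_nonneg less_imp_le order_trans)
      qed (use True elim sg eta k d that in auto)
      have cg: "continuous_on {0..T} (\<lambda>s. (lam (X s \<omega>))\<^sup>2 / \<sigma>\<^sup>2)"
        using sg by (intro continuous_intros continuous_on_compose2[OF class_D_continuous[OF D] cX]) auto
      have eT: "\<eta> * T \<le> T" "0 \<le> \<eta> * T" using eta T by auto
      have "(1 - \<eta>) ^ 5 * T * k\<^sup>2 = (T - \<eta> * T) * ((1 - \<eta>) ^ 4 * k\<^sup>2)" by (simp add: algebra_simps eval_nat_numeral)
      also have "\<dots> = integral {\<eta> * T..T} (\<lambda>_. (1 - \<eta>) ^ 4 * k\<^sup>2)" using eT by simp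
      also have "\<dots> \<le> integral {\<eta> * T..T} (\<lambda>s. (lam (X s \<omega>))\<^sup>2 / \<sigma>\<^sup>2)"
      proof (rule integral_le)
        show "(\<lambda>s. (lam (X s \<omega>))\<^sup>2 / \<sigma>\<^sup>2) integrable_on {\<eta> * T..T}"
          using cg eT by (intro integrable_continuous_real) (auto elim: continuous_on_subset)
        fix s assume s: "s \<in> {\<eta> * T..T}"
        have "- lam (R - 2 * \<sigma> * d) \<le> - lam (X s \<omega>)"
          using up[of s] s class_D_antimono[OF D] by (auto dest: antimonoD)
        then have "(1 - \<eta>)\<^sup>2 * \<sigma> * k \<le> - lam (X s \<omega>)" using lev by simp
        then have "((1 - \<eta>)\<^sup>2 * \<sigma> * k)\<^sup>2 \<le> (- lam (X s \<omega>))\<^sup>2"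
          using sg k by (intro power_mono) auto
        then show "(1 - \<eta>) ^ 4 * k\<^sup>2 \<le> (lam (X s \<omega>))\<^sup>2 / \<sigma>\<^sup>2"
          using sg by (simp add: power_mult_distrib field_simps flip: power_mult)
      qed auto
      also have "\<dots> \<le> integral {0..T} (\<lambda>s. (lam (X s \<omega>))\<^sup>2 / \<sigma>\<^sup>2)"
        using cg eT by (intro integral_subset_le integrable_continuous_real) (auto elim: continuous_on_subset)
      also have "\<dots> = (LINT s:{0..T}|lborel. (lam (X s \<omega>))\<^sup>2 / \<sigma>\<^sup>2)"
        by (rule LINT_continuous_eq_integral(2)[OF cg, symmetric])
      finally have "a * ((1 - \<eta>) ^ 5 * T * k\<^sup>2) \<le> a * (LINT s:{0..T}|lborel. (lam (X s \<omega>))\<^sup>2 / \<sigma>\<^sup>2)"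
        using a by (intro mult_left_mono) auto
      moreover have "(1/2 + 2 * g) * (T * k\<^sup>2) \<le> a * (1 - \<eta>) ^ 5 * (T * k\<^sup>2)"
        using pow T by (intro mult_right_mono) auto
      ultimately have "(1/2 + 2 * g) * T * k\<^sup>2 \<le> a * (LINT s:{0..T}|lborel. (lam (X s \<omega>))\<^sup>2 / \<sigma>\<^sup>2)"
        by (simp add: mult.assoc)
      then show ?thesis using True by (simp add: ennreal_leI)
    qed simp
  qed
  then have "(\<integral>\<^sup>+\<omega>. ennreal (exp ((1/2 + 2 * g) * T * k\<^sup>2)) * indicator A \<omega> \<partial>M) \<le> drift_exp_moment M lam \<sigma> X a T"
    unfolding drift_exp_moment_def by (rule nn_integral_mono_AE)
  also have "(\<integral>\<^sup>+\<omega>. ennreal (exp ((1/2 + 2 * g) * T * k\<^sup>2)) * indicator A \<omega> \<partial>M)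
      = ennreal (exp ((1/2 + 2 * g) * T * k\<^sup>2) * measure M A)"
    using A(1) by (simp add: nn_integral_cmult_indicator emeasure_eq_measure ennreal_mult')
  finally have le: "exp ((1/2 + 2 * g) * T * k\<^sup>2) * measure M A \<le> r"
    using r by simp
  have "4 * T / d\<^sup>2 = (4 / c0\<^sup>2) * T * k\<^sup>2" using k by (simp add: d_def power_divide)
  then have "4 * T / d\<^sup>2 = g * T * k\<^sup>2" using c0 by simp
  moreover have "\<bar>k\<bar> * d = c0" using k by (simp add: d_def)
  ultimately have e1: "(1/2 + 2 * g) * T * k\<^sup>2 + (- k\<^sup>2 * T / 2 - 4 * T / d\<^sup>2 - \<bar>k\<bar> * d) = g * T * k\<^sup>2 - c0"
    by (simp add: algebra_simps)
  have "exp (g * T * k\<^sup>2 - c0) * q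
      = exp ((1/2 + 2 * g) * T * k\<^sup>2) * (exp (- k\<^sup>2 * T / 2 - 4 * T / d\<^sup>2 - \<bar>k\<bar> * d) * q)"
    unfolding e1[symmetric] exp_add by simp
  also have "\<dots> \<le> exp ((1/2 + 2 * g) * T * k\<^sup>2) * measure M A"
    using A(3) unfolding q_def by (intro mult_left_mono) auto
  also note le
  finally have f1: "exp (g * T * k\<^sup>2 - c0) * q \<le> r" .
  have "k * 1 \<le> k * k" using k by (intro mult_left_mono) auto
  then have "g * T * k \<le> g * T * k\<^sup>2" using g T by (intro mult_left_mono) (auto simp: power2_eq_square)
  moreover have "r / q + c0 \<le> g * T * k" using k g T by (simp add: field_simps)
  ultimately have "r / q < exp (g * T * k\<^sup>2 - c0)"
    using exp_ge_add_one_self[of "g * T * k\<^sup>2 - c0"] by linarith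
  then have "r < exp (g * T * k\<^sup>2 - c0) * q" using q by (simp add: field_simps)
  then show False using f1 by simp
qed

section \<open>Finiteness of the moment below the critical value\<close>

text \<open>One clamping level. The extra 1 in \<open>R + 1\<close> is room for an Euler path within
  distance 1 of a solution bounded by \<open>R\<close>. \<open>B\<close> and \<open>L\<close> may
  grow with the level, while \<open>C\<close> and \<open>V\<close> can be chosen once for all
  levels. The coefficient \<open>1 - 2 * a\<close> is what the Girsanov budget leaves to the
  slope.\<close>

locale clamped_drift =
  fixes \<sigma> a C B L R :: real and lam lr V :: "real \<Rightarrow> real"
  assumes sigma: "0 < \<sigma>" and a: "0 \<le> a" "a < 1/2" and C: "0 \<le> C" and B: "0 \<le> B" and L: "0 < L"
    and lr_eq: "\<And>y. \<bar>y\<bar> \<le> R + 1 \<Longrightarrow> lr y = lam y"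
    and lr_bound: "\<And>y. \<bar>lr y\<bar> \<le> B"
    and lr_lipschitz: "\<And>y z. \<bar>lr y - lr z\<bar> \<le> L * \<bar>y - z\<bar>"
    and lam_deriv: "\<And>y. (lam has_real_derivative (- slope_q lam y)) (at y)"
    and slope_bound: "\<And>y. slope_q lam y \<le> (1 - 2 * a) * (lam y)\<^sup>2 / \<sigma>\<^sup>2 + C"
    and V_deriv: "\<And>y. (V has_real_derivative (- lam y / \<sigma>\<^sup>2)) (at y)"
    and V_nonneg: "\<And>y. 0 \<le> V y"
begin

definition quad_rate :: "real \<Rightarrow> real" where
  "quad_rate y = (1 - 2 * a) * (lr y)\<^sup>2 / \<sigma>\<^sup>2 + C + 1"

definition quad_bound :: real where
  "quad_bound = (1 - 2 * a) * B\<^sup>2 / \<sigma>\<^sup>2 + C + 1"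

lemma lr_sq_bound: "(lr y)\<^sup>2 \<le> B\<^sup>2"
  using lr_bound B by (metis abs_of_nonneg abs_le_square_iff)

lemma quad_rate_bounds: "1 \<le> quad_rate y" "quad_rate y \<le> quad_bound" "1 \<le> quad_bound"
proof -
  show "1 \<le> quad_rate y" using a C by (simp add: quad_rate_def)
  show "quad_rate y \<le> quad_bound" unfolding quad_rate_def quad_bound_def using a lr_sq_bound
    by (intro add_right_mono divide_right_mono mult_left_mono) auto
  show "1 \<le> quad_bound" using a C by (simp add: quad_bound_def)
qed

lemma lr_sq_lipschitz: "\<bar>(lr y)\<^sup>2 - (lr z)\<^sup>2\<bar> \<le> 2 * B * L * \<bar>y - z\<bar>"
proof -
  have "\<bar>(lr y)\<^sup>2 - (lr z)\<^sup>2\<bar> = \<bar>lr y + lr z\<bar> * \<bar>lr y - lr z\<bar>"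
    by (simp add: power2_eq_square algebra_simps flip: abs_mult)
  also have "\<dots> \<le> (2 * B) * (L * \<bar>y - z\<bar>)"
    using lr_bound[of y] lr_bound[of z] lr_lipschitz[of y z] B by (intro mult_mono) auto
  finally show ?thesis by (simp add: mult.assoc)
qed

definition euler_step :: "real \<Rightarrow> real \<Rightarrow> real \<Rightarrow> real" where
  "euler_step h y \<xi> = y + h * lr y + \<sigma> * \<xi>"

text \<open>
  The last two factors normalise the Gaussian mean to 1. Near \<open>y\<close> the rate \<open>quad_rate y\<close> exceeds
  the slope by at least \<open>1/2\<close>, and this margin absorbs the Taylor remainder in \<open>girsanov_factor_ge\<close>.
\<close>

definition girsanov_factor :: "real \<Rightarrow> real \<Rightarrow> real \<Rightarrow> real" where
  "girsanov_factor h y \<xi> = exp (- lr y / \<sigma> * \<xi> + quad_rate y / 2 * \<xi>\<^sup>2) *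
    (sqrt (1 - quad_rate y * h) * exp (- ((lr y)\<^sup>2 / \<sigma>\<^sup>2 * h / (2 * (1 - quad_rate y * h)))))"

lemma nn_integral_girsanov_factor:
  assumes h: "0 < h" "quad_bound * h \<le> 1/2"
  shows "(\<integral>\<^sup>+\<xi>. ennreal (girsanov_factor h y \<xi>) \<partial>gauss h) = 1"
proof -
  have "quad_rate y * h \<le> quad_bound * h" using h quad_rate_bounds by (intro mult_right_mono) auto
  then have ch: "quad_rate y * h < 1" using h by linarith
  let ?k = "sqrt (1 - quad_rate y * h) * exp (- ((lr y)\<^sup>2 / \<sigma>\<^sup>2 * h / (2 * (1 - quad_rate y * h))))"
  have "(\<integral>\<^sup>+\<xi>. ennreal (girsanov_factor h y \<xi>) \<partial>gauss h)
    = (\<integral>\<^sup>+\<xi>. ennreal (exp (- lr y / \<sigma> * \<xi> + quad_rate y / 2 * \<xi>\<^sup>2)) * ennreal ?k \<partial>gauss h)"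
    unfolding girsanov_factor_def by (intro nn_integral_cong ennreal_mult') simp
  also have "\<dots> = (\<integral>\<^sup>+\<xi>. ennreal (exp (- lr y / \<sigma> * \<xi> + quad_rate y / 2 * \<xi>\<^sup>2)) \<partial>gauss h) * ennreal ?k"
    by (rule nn_integral_multc) simp
  also have "\<dots> = ennreal (exp ((- lr y / \<sigma>)\<^sup>2 * h / (2 * (1 - quad_rate y * h))) / sqrt (1 - quad_rate y * h)) * ennreal ?k"
    by (simp only: nn_integral_gauss_exp_quadratic[OF h(1) ch])
  also have "\<dots> = ennreal (exp ((- lr y / \<sigma>)\<^sup>2 * h / (2 * (1 - quad_rate y * h))) / sqrt (1 - quad_rate y * h) * ?k)"
    using ch by (intro ennreal_mult'[symmetric]) auto
  also have "\<dots> = 1"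
    using ch by (simp add: power_divide exp_minus)
  finally show ?thesis .
qed

text \<open>Coefficient of \<open>h\<^sup>2\<close>, collecting in this order the drift part of the
  squared step in the Taylor term, the expansion of \<open>ln (1 - c * h)\<close> and that of
  \<open>1 / (1 - c * h)\<close>. Summed over \<open>T / h\<close> steps it still vanishes with the
  mesh.\<close>

definition step_error :: real where
  "step_error = quad_bound * (1 + 2 * quad_bound) * B\<^sup>2 / \<sigma>\<^sup>2 / 2 + quad_bound\<^sup>2 + B\<^sup>2 * quad_bound / \<sigma>\<^sup>2"

section \<open>Pathwise one-step bound for the Girsanov factor\<close>

lemma V_taylor:
  assumes q: "\<And>t. \<lbrakk>min y z \<le> t; t \<le> max y z\<rbrakk> \<Longrightarrow> slope_q lam t \<le> m"
  shows "V z \<le> V y - lam y / \<sigma>\<^sup>2 * (z - y) + m / (2 * \<sigma>\<^sup>2) * (z - y)\<^sup>2"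
proof (cases "z = y")
  case False
  define df where "df = (\<lambda>m::nat. if m = 0 then V else if m = 1 then (\<lambda>y. - lam y / \<sigma>\<^sup>2) else (\<lambda>y. slope_q lam y / \<sigma>\<^sup>2))"
  have "\<exists>t. (if z < y then z < t \<and> t < y else y < t \<and> t < z) \<and>
     V z = (\<Sum>m<2. df m y / fact m * (z - y) ^ m) + df 2 t / fact 2 * (z - y) ^ 2"
  proof (rule Taylor[where a = "min y z" and b = "max y z"])
    show "\<forall>m t. m < 2 \<and> min y z \<le> t \<and> t \<le> max y z \<longrightarrow> (df m has_real_derivative df (Suc m) t) (at t)"
    proof (intro allI impI)
      fix m :: nat and t assume m: "m < 2 \<and> min y z \<le> t \<and> t \<le> max y z"
      have "((\<lambda>y. - lam y / \<sigma>\<^sup>2) has_real_derivative slope_q lam t / \<sigma>\<^sup>2) (at t)"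
        using DERIV_cdivide[OF DERIV_minus[OF lam_deriv[of t]], of "\<sigma>\<^sup>2"] by simp
      moreover have "m = 0 \<or> m = 1" using m by auto
      ultimately show "(df m has_real_derivative df (Suc m) t) (at t)"
        using V_deriv[of t] by (auto simp: df_def)
    qed
  qed (use False in \<open>auto simp: df_def\<close>)
  then obtain t where t: "(if z < y then z < t \<and> t < y else y < t \<and> t < z)"
     "V z = V y - lam y / \<sigma>\<^sup>2 * (z - y) + slope_q lam t / (2 * \<sigma>\<^sup>2) * (z - y)\<^sup>2"
    by (auto simp: df_def eval_nat_numeral mult.commute)
  have "slope_q lam t \<le> m" using t(1) by (intro q) (auto split: if_splits)
  then have "slope_q lam t / (2 * \<sigma>\<^sup>2) * (z - y)\<^sup>2 \<le> m / (2 * \<sigma>\<^sup>2) * (z - y)\<^sup>2"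
    by (intro mult_right_mono divide_right_mono) auto
  then show ?thesis using t(2) by simp
qed simp

text \<open>Stands in for Ito's formula. With \<open>p = (lr y)\<^sup>2 / \<sigma>\<^sup>2\<close>
  and up to \<open>h\<^sup>2\<close>, \<open>V z - V y\<close> is at most
  \<open>- lr y / \<sigma> * \<xi> + c / 2 * \<xi>\<^sup>2 - p * h\<close>. The first two terms are
  the exponent of the factor, whose normalisation costs \<open>(p + c) * h / 2\<close>. The balance
  \<open>(p - c) * h / 2\<close> equals \<open>a * p * h - (C + 1) / 2 * h\<close> by the choice of
  \<open>quad_rate\<close>.\<close>

lemma girsanov_factor_ge:
  assumes h: "0 < h" "quad_bound * h \<le> 1/2"
    and y: "\<bar>y\<bar> \<le> R + 1" and z: "\<bar>z\<bar> \<le> R + 1" and zdef: "z = euler_step h y \<xi>"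
    and small: "(1 - 2 * a) / \<sigma>\<^sup>2 * (2 * B * L * \<bar>z - y\<bar>) \<le> 1/2"
  shows "exp (V z - V y + h * (a * (lr y)\<^sup>2 / \<sigma>\<^sup>2 - (C + 1) / 2) - step_error * h\<^sup>2) \<le> girsanov_factor h y \<xi>"
proof -
  define c where "c = quad_rate y"
  define d where "d = z - y"
  define p where "p = (lr y)\<^sup>2 / \<sigma>\<^sup>2"
  have c: "1 \<le> c" "c \<le> quad_bound" using quad_rate_bounds by (auto simp: c_def)
  have "c * h \<le> quad_bound * h" using h c by (intro mult_right_mono) auto
  then have ch: "c * h \<le> 1/2" "0 \<le> c * h" using h c by (linarith, simp)
  have p: "0 \<le> p" "p \<le> B\<^sup>2 / \<sigma>\<^sup>2" using lr_sq_bound by (auto simp: p_def divide_right_mono)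
  have d: "d = h * lr y + \<sigma> * \<xi>" by (simp add: d_def zdef euler_step_def)
  \<comment> \<open>The \<open>+ 1\<close> in \<open>quad_rate\<close> is split in two: one half
    covers the variation of the slope bound along the step, which is the role of
    \<open>small\<close>, the other half covers the cross term between drift and noise.\<close>
  have "V z \<le> V y - lam y / \<sigma>\<^sup>2 * (z - y) + (c - 1/2) / (2 * \<sigma>\<^sup>2) * (z - y)\<^sup>2"
  proof (rule V_taylor)
    fix t assume t: "min y z \<le> t" "t \<le> max y z"
    have "\<bar>t\<bar> \<le> R + 1" using t y z by (auto simp: min_def max_def split: if_splits)
    then have lt: "lr t = lam t" by (rule lr_eq)
    have ty: "\<bar>t - y\<bar> \<le> \<bar>z - y\<bar>" using t by (auto simp: min_def max_def split: if_splits)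
    have "(lr t)\<^sup>2 - (lr y)\<^sup>2 \<le> 2 * B * L * \<bar>t - y\<bar>" using lr_sq_lipschitz[of t y] by linarith
    also have "\<dots> \<le> 2 * B * L * \<bar>z - y\<bar>" using ty B L by (intro mult_left_mono) auto
    finally have "(1 - 2 * a) / \<sigma>\<^sup>2 * ((lr t)\<^sup>2 - (lr y)\<^sup>2) \<le> (1 - 2 * a) / \<sigma>\<^sup>2 * (2 * B * L * \<bar>z - y\<bar>)"
      using a by (intro mult_left_mono) auto
    also note small
    also have "(1 - 2 * a) / \<sigma>\<^sup>2 * ((lr t)\<^sup>2 - (lr y)\<^sup>2)
      = (1 - 2 * a) * (lr t)\<^sup>2 / \<sigma>\<^sup>2 - (1 - 2 * a) * (lr y)\<^sup>2 / \<sigma>\<^sup>2"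
      by (simp add: right_diff_distrib)
    finally show "slope_q lam t \<le> c - 1/2" using slope_bound[of t] unfolding lt c_def quad_rate_def by linarith
  qed
  then have T1: "V z - V y \<le> - (lr y / \<sigma>\<^sup>2 * d) + (c - 1/2) / (2 * \<sigma>\<^sup>2) * d\<^sup>2"
    using lr_eq[OF y] by (simp add: d_def)
  have T2: "(c - 1/2) / (2 * \<sigma>\<^sup>2) * d\<^sup>2 \<le> c / 2 * \<xi>\<^sup>2 + quad_bound * (1 + 2 * quad_bound) * B\<^sup>2 / \<sigma>\<^sup>2 / 2 * h\<^sup>2"
  proof -
    \<comment> \<open>Young's inequality with this weight inflates \<open>c - 1/2\<close> to at most
      \<open>c\<close> in front of the noise, and leaves a drift part of order
      \<open>h\<^sup>2\<close>.\<close>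
    define et where "et = 1 / (2 * quad_bound)"
    have et: "0 < et" using quad_rate_bounds by (simp add: et_def)
    have expand: "(c - 1/2) / (2 * \<sigma>\<^sup>2) * ((1 + et) * (\<sigma> * \<xi>)\<^sup>2 + (1 + u) * (h * lr y)\<^sup>2)
      = (c - 1/2) * (1 + et) * \<xi>\<^sup>2 / 2 + (c - 1/2) * (1 + u) * p * h\<^sup>2 / 2" for u
      using sigma by (simp add: p_def field_simps power2_eq_square)
    have "0 \<le> (sqrt et * (\<sigma> * \<xi>) - h * lr y / sqrt et)\<^sup>2" by simp
    also have "\<dots> = et * (\<sigma> * \<xi>)\<^sup>2 - 2 * (h * lr y) * (\<sigma> * \<xi>) + (h * lr y)\<^sup>2 / et"
      using et by (simp add: power2_diff power_mult_distrib power_divide)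
    finally have "d\<^sup>2 \<le> (1 + et) * (\<sigma> * \<xi>)\<^sup>2 + (1 + 1 / et) * (h * lr y)\<^sup>2"
      unfolding d by (simp add: power2_sum algebra_simps)
    then have "(c - 1/2) / (2 * \<sigma>\<^sup>2) * d\<^sup>2 \<le> (c - 1/2) / (2 * \<sigma>\<^sup>2) * ((1 + et) * (\<sigma> * \<xi>)\<^sup>2 + (1 + 1 / et) * (h * lr y)\<^sup>2)"
      using c by (intro mult_left_mono) auto
    also have "\<dots> = (c - 1/2) * (1 + et) * \<xi>\<^sup>2 / 2 + (c - 1/2) * (1 + 1 / et) * p * h\<^sup>2 / 2"
      by (rule expand)
    also have "\<dots> \<le> c * \<xi>\<^sup>2 / 2 + quad_bound * (1 + 2 * quad_bound) * (B\<^sup>2 / \<sigma>\<^sup>2) * h\<^sup>2 / 2"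
    proof (intro add_mono divide_right_mono mult_right_mono mult_mono)
      have "(c - 1/2) * et \<le> quad_bound * et" using c et by (intro mult_right_mono) auto
      also have "quad_bound * et = 1/2" using quad_rate_bounds by (simp add: et_def)
      finally show "(c - 1/2) * (1 + et) \<le> c" by (simp add: algebra_simps)
      show "1 / et \<le> 2 * quad_bound" by (simp add: et_def)
    qed (use c p et in auto)
    finally show ?thesis by simp
  qed
  have "quad_bound * (1 + 2 * quad_bound) * B\<^sup>2 / \<sigma>\<^sup>2 / 2 * h\<^sup>2 = step_error * h\<^sup>2 - quad_bound\<^sup>2 * h\<^sup>2 - B\<^sup>2 * quad_bound / \<sigma>\<^sup>2 * h\<^sup>2"
    by (simp add: step_error_def algebra_simps)
  note T2 = T2[unfolded this]
  have T3: "- (c * h) - 2 * (quad_bound\<^sup>2 * h\<^sup>2) \<le> ln (1 - c * h)"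
  proof -
    have "(c * h)\<^sup>2 \<le> (quad_bound * h)\<^sup>2" using c h ch by (intro power_mono mult_right_mono) auto
    then show ?thesis using ln_one_minus_pos_lower_bound[OF ch(2,1)] by (simp add: power_mult_distrib)
  qed
  have T4: "p * h / (2 * (1 - c * h)) \<le> p * h / 2 + B\<^sup>2 * quad_bound / \<sigma>\<^sup>2 * h\<^sup>2"
  proof -
    have "c * h * (2 * (c * h)) \<le> c * h * 1" using ch by (intro mult_left_mono) auto
    then have "1 \<le> (1 - c * h) * (1 + 2 * (c * h))" by (simp add: algebra_simps)
    then have "1 / (1 - c * h) \<le> 1 + 2 * (c * h)" using ch by (simp add: field_simps)
    then have "(p * h / 2) * (1 / (1 - c * h)) \<le> (p * h / 2) * (1 + 2 * (c * h))"
      using p h by (intro mult_left_mono) auto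
    moreover have "p * c * h\<^sup>2 \<le> (B\<^sup>2 / \<sigma>\<^sup>2) * quad_bound * h\<^sup>2"
      using p c by (intro mult_right_mono mult_mono) auto
    ultimately show ?thesis by (simp add: algebra_simps power2_eq_square)
  qed
  have T5: "- (lr y / \<sigma>\<^sup>2 * d) = - lr y / \<sigma> * \<xi> - p * h"
    using sigma unfolding d p_def by (simp add: field_simps power2_eq_square)
  have T6: "h * (a * (lr y)\<^sup>2 / \<sigma>\<^sup>2 - (C + 1) / 2) = p * h / 2 - c * h / 2"
    by (simp add: p_def c_def quad_rate_def field_simps flip: diff_divide_distrib add_divide_distrib)
  have "V z - V y + h * (a * (lr y)\<^sup>2 / \<sigma>\<^sup>2 - (C + 1) / 2) - step_error * h\<^sup>2
    \<le> (- lr y / \<sigma> * \<xi> + c / 2 * \<xi>\<^sup>2) + (ln (1 - c * h) / 2 + - (p * h / (2 * (1 - c * h))))"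
    using T1 T2 T3 T4 unfolding T5 T6 by linarith
  then have "exp (V z - V y + h * (a * (lr y)\<^sup>2 / \<sigma>\<^sup>2 - (C + 1) / 2) - step_error * h\<^sup>2)
    \<le> exp (- lr y / \<sigma> * \<xi> + c / 2 * \<xi>\<^sup>2) * (exp (ln (1 - c * h) / 2) * exp (- (p * h / (2 * (1 - c * h)))))"
    by (simp only: exp_le_cancel_iff flip: exp_add)
  also have "exp (ln (1 - c * h) / 2) = sqrt (1 - c * h)"
    using ch by (simp add: exp_ln_iff ln_sqrt[symmetric])
  finally show ?thesis by (simp only: girsanov_factor_def p_def c_def)
qed

section \<open>Mean of the Euler weights and their limit along a solution path\<close>

lemma euler_step_measurable: "case_prod (euler_step h) \<in> borel_measurable (borel \<Otimes>\<^sub>M borel)"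
  and girsanov_factor_measurable: "case_prod (girsanov_factor h) \<in> borel_measurable (borel \<Otimes>\<^sub>M borel)"
proof -
  have "continuous_on UNIV lr"
  proof (rule lipschitz_on_continuous_on)
    show "L-lipschitz_on UNIV lr" using L lr_lipschitz by (auto simp: lipschitz_on_def dist_real_def)
  qed
  then have [measurable]: "lr \<in> borel_measurable borel" by (rule borel_measurable_continuous_onI)
  have [measurable]: "quad_rate \<in> borel_measurable borel" unfolding quad_rate_def by measurable
  show "case_prod (euler_step h) \<in> borel_measurable (borel \<Otimes>\<^sub>M borel)" unfolding euler_step_def by measurable
  show "case_prod (girsanov_factor h) \<in> borel_measurable (borel \<Otimes>\<^sub>M borel)" unfolding girsanov_factor_def by measurable
qed

lemma nn_integral_path_weight_girsanov_factor:
  assumes h: "0 < h" "quad_bound * h \<le> 1/2"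
  shows "(\<integral>\<^sup>+v. path_weight x (euler_step h) (\<lambda>y \<xi>. ennreal (girsanov_factor h y \<xi>)) n v \<partial>Pi\<^sub>M {..<n} (\<lambda>_. gauss h)) = 1"
proof (induction n)
  case 0
  show ?case by (simp add: path_weight_def PiM_empty)
next
  case (Suc n)
  have dm: "case_prod (\<lambda>y \<xi>. ennreal (girsanov_factor h y \<xi>)) \<in> borel_measurable (borel \<Otimes>\<^sub>M borel)"
    using girsanov_factor_measurable by (simp add: split_beta')
  show ?case
    using nn_integral_path_weight_Suc[OF euler_step_measurable dm, where ps = "\<lambda>_. 1" and N = "gauss h" and ?s0.0 = x and n = n]
      prob_space_gauss[OF h(1)] Suc by (simp add: nn_integral_girsanov_factor[OF h])
qed

text \<open>The noise is additive, so it cancels between scheme and solution and only the freezing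
  of the drift contributes: a deterministic Gronwall estimate in the modulus of continuity
  \<open>om\<close>. As \<open>lr\<close> is globally Lipschitz, only \<open>X\<close>, and not the
  scheme, has to stay in the region of agreement.\<close>

lemma euler_scheme_close:
  fixes X w :: "real \<Rightarrow> real" and n :: nat
  assumes T: "0 < T" and n: "0 < n" and cX: "continuous_on {0..T} X"
    and clam: "continuous_on UNIV lam"
    and X: "\<And>t. 0 \<le> t \<Longrightarrow> t \<le> T \<Longrightarrow> X t = x + (LINT s:{0..t}|lborel. lam (X s)) + \<sigma> * w t"
    and w0: "w 0 = 0"
    and XR: "\<And>t. 0 \<le> t \<Longrightarrow> t \<le> T \<Longrightarrow> \<bar>X t\<bar> \<le> R"
    and osc: "\<And>s t. \<lbrakk>0 \<le> s; s \<le> t; t \<le> T; t - s \<le> T / n\<rbrakk> \<Longrightarrow> \<bar>X s - X t\<bar> \<le> om"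
    and om: "0 \<le> om"
  defines "h \<equiv> T / n"
  defines "Y \<equiv> chain x (euler_step h) (\<lambda>i. w (real (Suc i) * h) - w (real i * h))"
  assumes i: "i \<le> n"
  shows "\<bar>Y i - X (real i * h)\<bar> \<le> om * exp (L * T)"
proof -
  have h: "0 < h" using T n by (simp add: h_def)
  have ih: "real i * h \<le> T" if "i \<le> n" for i
  proof -
    have "real i * h \<le> real n * h" using that h by (intro mult_right_mono) auto
    then show ?thesis using n by (simp add: h_def)
  qed
  have cl: "continuous_on {0..T} (\<lambda>u. lam (X u))"
    by (rule continuous_on_compose2[OF clam cX]) auto
  have "(LINT s:{0..0}|lborel. lam (X s)) = integral {0..0} (\<lambda>s. lam (X s))"
    by (rule LINT_continuous_eq_integral(2)) simp
  then have X0: "X 0 = x" using X[of 0] T w0 by simp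
  \<comment> \<open>Adding \<open>om\<close> absorbs the inhomogeneous term, so each step is a pure
    multiplication by \<open>1 + L * h\<close>.\<close>
  have "\<bar>Y i - X (real i * h)\<bar> + om \<le> om * (1 + L * h) ^ i"
    using i
  proof (induction i)
    case 0
    then show ?case using X0 by (simp add: Y_def)
  next
    case (Suc i)
    define s where "s = real i * h"
    define t where "t = real (Suc i) * h"
    have st: "0 \<le> s" "s \<le> t" "t \<le> T" "t - s = h" "s \<le> T"
      using h ih[of "Suc i"] ih[of i] Suc by (auto simp: s_def t_def algebra_simps)
    have cst: "continuous_on {s..t} (\<lambda>u. lam (X u))" using cl st by (rule_tac continuous_on_subset) auto
    have "integral {0..s} (\<lambda>u. lam (X u)) + integral {s..t} (\<lambda>u. lam (X u)) = integral {0..t} (\<lambda>u. lam (X u))"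
      using st by (intro Henstock_Kurzweil_Integration.integral_combine integrable_continuous_real)
        (auto intro: continuous_on_subset[OF cl])
    moreover have "(LINT u:{0..r}|lborel. lam (X u)) = integral {0..r} (\<lambda>u. lam (X u))" if "r \<le> T" for r
      using that by (intro LINT_continuous_eq_integral continuous_on_subset[OF cl]) auto
    ultimately have Xst: "X t = X s + integral {s..t} (\<lambda>u. lam (X u)) + \<sigma> * (w t - w s)"
      using X[of s] X[of t] st by (simp add: algebra_simps)
    have "Y (Suc i) = Y i + h * lr (Y i) + \<sigma> * (w t - w s)"
      by (simp add: Y_def euler_step_def s_def t_def)
    then have "Y (Suc i) - X t = (Y i - X s) + (h * lr (Y i) - integral {s..t} (\<lambda>u. lam (X u)))"
      using Xst by simp
    also have "h * lr (Y i) - integral {s..t} (\<lambda>u. lam (X u)) = integral {s..t} (\<lambda>u. lr (Y i) - lam (X u))"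
      using st by (subst Henstock_Kurzweil_Integration.integral_diff) (auto intro: integrable_continuous_real cst)
    finally have eq: "Y (Suc i) - X t = (Y i - X s) + integral {s..t} (\<lambda>u. lr (Y i) - lam (X u))" .
    have "norm (integral {s..t} (\<lambda>u. lr (Y i) - lam (X u))) \<le> L * (\<bar>Y i - X s\<bar> + om) * (t - s)"
    proof (rule integral_bound)
      fix u assume u: "u \<in> {s..t}"
      have "lam (X u) = lr (X u)" using XR[of u] u st by (intro lr_eq[symmetric]) auto
      then have "\<bar>lr (Y i) - lam (X u)\<bar> \<le> L * \<bar>Y i - X u\<bar>" using lr_lipschitz by simp
      also have "\<dots> \<le> L * (\<bar>Y i - X s\<bar> + om)"
        using osc[of s u] u st L by (intro mult_left_mono) (auto simp: h_def)
      finally show "norm (lr (Y i) - lam (X u)) \<le> L * (\<bar>Y i - X s\<bar> + om)" by simp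
    qed (use st in \<open>auto intro!: continuous_intros cst\<close>)
    then have "\<bar>Y (Suc i) - X t\<bar> + om \<le> (\<bar>Y i - X s\<bar> + om) * (1 + L * h)"
      using eq st by (simp add: algebra_simps)
    also have "\<dots> \<le> om * (1 + L * h) ^ i * (1 + L * h)"
      using Suc L h by (intro mult_right_mono) (auto simp: s_def)
    finally show ?case by (simp add: t_def ac_simps)
  qed
  also have "\<dots> \<le> om * exp (L * T)"
  proof (intro mult_left_mono om)
    have "(1 + L * h) ^ i \<le> exp (L * h) ^ i"
      using L h exp_ge_add_one_self[of "L * h"] by (intro power_mono) auto
    also have "\<dots> = exp (L * (real i * h))" by (simp add: ac_simps flip: exp_of_nat_mult)
    also have "\<dots> \<le> exp (L * T)" using ih[OF i] L by simp
    finally show "(1 + L * h) ^ i \<le> exp (L * T)" .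
  qed
  finally show ?thesis using om by simp
qed

text \<open>Telescoping of \<open>girsanov_factor_ge\<close>. The 2 in the exponent is one unit for
  comparing the integral with its Riemann sum and one for the accumulated \<open>step_error\<close>;
  the terminal \<open>V (Y n)\<close> is dropped by \<open>V_nonneg\<close>. Hence the left-hand
  side is free of \<open>B\<close>, \<open>L\<close> and \<open>R\<close>.\<close>

lemma eventually_path_weight_ge:
  fixes X w :: "real \<Rightarrow> real"
  assumes T: "0 < T" and cX: "continuous_on {0..T} X"
    and clam: "continuous_on UNIV lam"
    and X: "\<And>t. 0 \<le> t \<Longrightarrow> t \<le> T \<Longrightarrow> X t = x + (LINT s:{0..t}|lborel. lam (X s)) + \<sigma> * w t"
    and w0: "w 0 = 0"
    and XR: "\<And>t. 0 \<le> t \<Longrightarrow> t \<le> T \<Longrightarrow> \<bar>X t\<bar> \<le> R"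
  shows "eventually (\<lambda>n. ennreal (exp (a * (LINT s:{0..T}|lborel. (lam (X s))\<^sup>2 / \<sigma>\<^sup>2) - (V x + (C + 1) / 2 * T + 2)))
     \<le> path_weight x (euler_step (T / real n)) (\<lambda>y \<xi>. ennreal (girsanov_factor (T / real n) y \<xi>)) n
        (\<lambda>i. w (real (Suc i) * (T / real n)) - w (real i * (T / real n)))) sequentially"
proof -
  define M1 where "M1 = 2 * B * L / \<sigma>\<^sup>2"
  have M1: "0 \<le> M1" using B L by (simp add: M1_def)
  \<comment> \<open>The denominator meets two demands: one step moves the scheme by at most
    \<open>3 * del\<close>, which the smallness condition must tolerate, and the integral error
    \<open>2 * M1 * T * del\<close> must be at most 1.\<close>
  define del where "del = 1 / (1 + 6 * M1 + 2 * M1 * T)"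
  have den: "1 \<le> 1 + 6 * M1 + 2 * M1 * T" using M1 T by simp
  have del: "0 < del" "del \<le> 1" using den by (auto simp: del_def)
  have delM: "3 * M1 * del \<le> 1/2" "2 * M1 * T * del \<le> 1"
  proof -
    have "0 \<le> M1 * T" using M1 T by simp
    then show "3 * M1 * del \<le> 1/2" "2 * M1 * T * del \<le> 1" using M1 den by (auto simp: del_def field_simps)
  qed
  \<comment> \<open>Cancels the Gronwall factor, so that the scheme stays within \<open>del\<close>
    of the solution.\<close>
  define om where "om = del * exp (- (L * T))"
  have om: "0 < om" "om * exp (L * T) = del" using del by (auto simp: om_def exp_minus)
  have "exp (- (L * T)) \<le> 1" using L T by simp
  then have omd: "om \<le> del" using del mult_left_mono[of "exp (- (L * T))" 1 del] by (simp add: om_def)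
  have "uniformly_continuous_on {0..T} X"
    by (rule compact_uniformly_continuous[OF cX]) simp
  then obtain dd where dd: "0 < dd" "\<And>s t. \<lbrakk>s \<in> {0..T}; t \<in> {0..T}; \<bar>s - t\<bar> < dd\<rbrakk> \<Longrightarrow> \<bar>X s - X t\<bar> < om"
    using om(1) unfolding uniformly_continuous_on_def dist_real_def by metis
  have lim: "(\<lambda>n. K * (T / real n)) \<longlonglongrightarrow> 0" for K
  proof -
    have "(\<lambda>n. (K * T) / real n) \<longlonglongrightarrow> 0" by (rule lim_const_over_n)
    then show ?thesis by simp
  qed
  have ev: "eventually (\<lambda>n. K * (T / real n) < e) sequentially" if "0 < e" for K e :: real
    using order_tendstoD(2)[OF lim that] .
  have ev2: "eventually (\<lambda>n. quad_bound * (T / real n) < 1/2) sequentially"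
    and ev3: "eventually (\<lambda>n. step_error * T * (T / real n) < 1) sequentially"
    by (rule ev, simp)+
  have cl2: "continuous_on {0..T} (\<lambda>s. (lam (X s))\<^sup>2 / \<sigma>\<^sup>2)"
    using sigma by (intro continuous_intros continuous_on_compose2[OF clam cX]) auto
  show ?thesis
    using ev[OF dd(1), of 1] ev2 ev3 eventually_gt_at_top[of 0]
  proof eventually_elim
    case (elim n)
    define h where "h = T / real n"
    have n: "0 < n" using elim by simp
    have h: "0 < h" using T n by (simp add: h_def)
    have nh: "real n * h = T" using n by (simp add: h_def)
    have Ch: "quad_bound * h \<le> 1/2" using elim(2) by (simp add: h_def)
    have Kh: "step_error * T * h \<le> 1" using elim(3) by (simp add: h_def)
    have hd: "h < dd" using elim(1) by (simp add: h_def)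
    have ih: "real i * h \<le> T" if "i \<le> n" for i
    proof -
      have "real i * h \<le> real n * h" using that h by (intro mult_right_mono) auto
      then show ?thesis using nh by simp
    qed
    have osc: "\<bar>X s - X t\<bar> \<le> om" if "0 \<le> s" "s \<le> t" "t \<le> T" "t - s \<le> h" for s t
      using dd(2)[of s t] that hd by force
    define v where "v = (\<lambda>i. w (real (Suc i) * h) - w (real i * h))"
    define Y where "Y = chain x (euler_step h) v"
    have close: "\<bar>Y i - X (real i * h)\<bar> \<le> del" if "i \<le> n" for i
      using euler_scheme_close[OF T n cX clam X w0 XR osc[unfolded h_def] less_imp_le[OF om(1)] that]
      unfolding om(2) Y_def v_def h_def .
    have Yb: "\<bar>Y i\<bar> \<le> R + 1" if "i \<le> n" for i
      using close[OF that] XR[of "real i * h"] ih[OF that] h del by auto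
    have ind: "exp (V (Y i) - V x + a * integral {0..real i * h} (\<lambda>s. (lam (X s))\<^sup>2 / \<sigma>\<^sup>2)
        - real i * h * (2 * M1 * del + (C + 1) / 2 + step_error * h)) \<le> (\<Prod>j<i. girsanov_factor h (Y j) (v j))" if "i \<le> n" for i
      using that
    proof (induction i)
      case 0
      show ?case by (simp add: Y_def)
    next
      case (Suc i)
      define s where "s = real i * h"
      define t where "t = real (Suc i) * h"
      have st: "0 \<le> s" "s \<le> t" "t \<le> T" "t - s = h" "s \<le> T" "t = s + h"
        using h ih[of "Suc i"] ih[of i] Suc by (auto simp: s_def t_def algebra_simps)
      have i: "i \<le> n" using Suc by simp
      have YS: "Y (Suc i) = euler_step h (Y i) (v i)" by (simp add: Y_def)
      have dY: "\<bar>Y (Suc i) - Y i\<bar> \<le> 3 * del"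
        using close[OF Suc.prems] close[OF i] osc[of s t] st omd by (simp add: s_def t_def)
      have "(1 - 2 * a) / \<sigma>\<^sup>2 * (2 * B * L * \<bar>Y (Suc i) - Y i\<bar>) = (1 - 2 * a) * (M1 * \<bar>Y (Suc i) - Y i\<bar>)"
        by (simp add: M1_def)
      also have "\<dots> \<le> 1 * (M1 * (3 * del))"
        using a M1 dY by (intro mult_mono mult_left_mono) auto
      also have "\<dots> \<le> 1/2" using delM by (simp add: mult.commute mult.left_commute)
      finally have small: "(1 - 2 * a) / \<sigma>\<^sup>2 * (2 * B * L * \<bar>Y (Suc i) - Y i\<bar>) \<le> 1/2" .
      note dg = girsanov_factor_ge[OF h Ch Yb[OF i] Yb[OF Suc.prems] YS small]
      have c2: "continuous_on {s..t} (\<lambda>s. (lam (X s))\<^sup>2 / \<sigma>\<^sup>2)" using cl2 st by (rule_tac continuous_on_subset) auto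
      have "integral {s..t} (\<lambda>s. (lam (X s))\<^sup>2 / \<sigma>\<^sup>2) \<le> integral {s..t} (\<lambda>_. (lr (Y i))\<^sup>2 / \<sigma>\<^sup>2 + 2 * M1 * del)"
      proof (rule integral_le)
        fix u assume u: "u \<in> {s..t}"
        have "lam (X u) = lr (X u)" using XR[of u] u st by (intro lr_eq[symmetric]) auto
        then have "(lam (X u))\<^sup>2 - (lr (Y i))\<^sup>2 \<le> 2 * B * L * \<bar>X u - Y i\<bar>"
          using lr_sq_lipschitz[of "X u" "Y i"] by simp
        also have "\<dots> \<le> 2 * B * L * (2 * del)"
          using close[OF i] osc[of s u] st u omd B L by (intro mult_left_mono) (auto simp: s_def)
        finally have "((lam (X u))\<^sup>2 - (lr (Y i))\<^sup>2) / \<sigma>\<^sup>2 \<le> 2 * B * L * (2 * del) / \<sigma>\<^sup>2"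
          by (intro divide_right_mono) auto
        then show "(lam (X u))\<^sup>2 / \<sigma>\<^sup>2 \<le> (lr (Y i))\<^sup>2 / \<sigma>\<^sup>2 + 2 * M1 * del"
          by (simp add: M1_def diff_divide_distrib)
      qed (use c2 in \<open>auto intro: integrable_continuous_real\<close>)
      also have "\<dots> = h * ((lr (Y i))\<^sup>2 / \<sigma>\<^sup>2 + 2 * M1 * del)" using st by simp
      finally have "a * integral {s..t} (\<lambda>s. (lam (X s))\<^sup>2 / \<sigma>\<^sup>2) \<le> a * (h * ((lr (Y i))\<^sup>2 / \<sigma>\<^sup>2 + 2 * M1 * del))"
        using a by (intro mult_left_mono) auto
      also have "\<dots> = h * (a * (lr (Y i))\<^sup>2 / \<sigma>\<^sup>2) + a * (h * (2 * M1 * del))"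
        by (simp add: algebra_simps)
      also have "a * (h * (2 * M1 * del)) \<le> 1 * (h * (2 * M1 * del))"
        using a h M1 del by (intro mult_right_mono) auto
      finally have I1: "a * integral {s..t} (\<lambda>s. (lam (X s))\<^sup>2 / \<sigma>\<^sup>2) \<le> h * (a * (lr (Y i))\<^sup>2 / \<sigma>\<^sup>2) + h * (2 * M1 * del)"
        by simp
      have "integral {0..s} (\<lambda>s. (lam (X s))\<^sup>2 / \<sigma>\<^sup>2) + integral {s..t} (\<lambda>s. (lam (X s))\<^sup>2 / \<sigma>\<^sup>2)
        = integral {0..t} (\<lambda>s. (lam (X s))\<^sup>2 / \<sigma>\<^sup>2)"
        using st by (intro Henstock_Kurzweil_Integration.integral_combine integrable_continuous_real)
          (auto intro: continuous_on_subset[OF cl2])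
      then have I2: "a * integral {0..t} (\<lambda>s. (lam (X s))\<^sup>2 / \<sigma>\<^sup>2) = a * integral {0..s} (\<lambda>s. (lam (X s))\<^sup>2 / \<sigma>\<^sup>2)
          + a * integral {s..t} (\<lambda>s. (lam (X s))\<^sup>2 / \<sigma>\<^sup>2)"
        by (simp only: distrib_left[symmetric])
      have I3: "t * (A + q + step_error * h) = s * (A + q + step_error * h) + h * A + h * q + step_error * h\<^sup>2" for A q
        using st(6) by (simp add: algebra_simps power2_eq_square)
      have I3: "t * (2 * M1 * del + (C + 1) / 2 + step_error * h) = s * (2 * M1 * del + (C + 1) / 2 + step_error * h)
         + h * (2 * M1 * del) + h * ((C + 1) / 2) + step_error * h\<^sup>2"
        by (rule I3)
      have I4: "h * (a * (lr (Y i))\<^sup>2 / \<sigma>\<^sup>2 - (C + 1) / 2) = h * (a * (lr (Y i))\<^sup>2 / \<sigma>\<^sup>2) - h * ((C + 1) / 2)"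
        by (simp add: right_diff_distrib)
      have "exp (V (Y (Suc i)) - V x + a * integral {0..t} (\<lambda>s. (lam (X s))\<^sup>2 / \<sigma>\<^sup>2)
        - t * (2 * M1 * del + (C + 1) / 2 + step_error * h))
        \<le> exp ((V (Y i) - V x + a * integral {0..s} (\<lambda>s. (lam (X s))\<^sup>2 / \<sigma>\<^sup>2)
        - s * (2 * M1 * del + (C + 1) / 2 + step_error * h))
          + (V (Y (Suc i)) - V (Y i) + h * (a * (lr (Y i))\<^sup>2 / \<sigma>\<^sup>2 - (C + 1) / 2) - step_error * h\<^sup>2))"
        unfolding exp_le_cancel_iff I2 I3 I4 using I1 by linarith
      also have "\<dots> \<le> (\<Prod>j<i. girsanov_factor h (Y j) (v j)) * girsanov_factor h (Y i) (v i)"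
        unfolding exp_add s_def
        by (rule mult_mono[OF Suc.IH[OF i] dg order_trans[OF exp_ge_zero Suc.IH[OF i]] exp_ge_zero])
      finally show ?case by (simp add: t_def)
    qed
    have dpos: "0 \<le> girsanov_factor h (Y j) (v j)" if "j < n" for j
    proof -
      have "quad_rate (Y j) * h \<le> quad_bound * h" using h quad_rate_bounds by (intro mult_right_mono) auto
      then have "quad_rate (Y j) * h \<le> 1" using Ch by linarith
      then show ?thesis by (simp add: girsanov_factor_def)
    qed
    have J1: "(LINT s:{0..T}|lborel. (lam (X s))\<^sup>2 / \<sigma>\<^sup>2) = integral {0..T} (\<lambda>s. (lam (X s))\<^sup>2 / \<sigma>\<^sup>2)"
      by (rule LINT_continuous_eq_integral(2)[OF cl2])
    have J2: "T * (2 * M1 * del + (C + 1) / 2 + step_error * h) = 2 * M1 * T * del + (C + 1) / 2 * T + step_error * T * h"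
      by (simp add: algebra_simps)
    have "a * (LINT s:{0..T}|lborel. (lam (X s))\<^sup>2 / \<sigma>\<^sup>2) - (V x + (C + 1) / 2 * T + 2)
      \<le> V (Y n) - V x + a * integral {0..real n * h} (\<lambda>s. (lam (X s))\<^sup>2 / \<sigma>\<^sup>2)
        - real n * h * (2 * M1 * del + (C + 1) / 2 + step_error * h)"
      using V_nonneg[of "Y n"] delM(2) Kh unfolding nh J1 J2 by linarith
    then have "exp (a * (LINT s:{0..T}|lborel. (lam (X s))\<^sup>2 / \<sigma>\<^sup>2) - (V x + (C + 1) / 2 * T + 2))
      \<le> exp (V (Y n) - V x + a * integral {0..real n * h} (\<lambda>s. (lam (X s))\<^sup>2 / \<sigma>\<^sup>2)
        - real n * h * (2 * M1 * del + (C + 1) / 2 + step_error * h))" by simp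
    also note ind[OF order_refl]
    finally have "exp (a * (LINT s:{0..T}|lborel. (lam (X s))\<^sup>2 / \<sigma>\<^sup>2) - (V x + (C + 1) / 2 * T + 2))
      \<le> (\<Prod>j<n. girsanov_factor h (Y j) (v j))" .
    then have "ennreal (exp (a * (LINT s:{0..T}|lborel. (lam (X s))\<^sup>2 / \<sigma>\<^sup>2) - (V x + (C + 1) / 2 * T + 2)))
      \<le> ennreal (\<Prod>j<n. girsanov_factor h (Y j) (v j))" by (rule ennreal_leI)
    also have "\<dots> = path_weight x (euler_step h) (\<lambda>y \<xi>. ennreal (girsanov_factor h y \<xi>)) n v"
      unfolding path_weight_def Y_def[symmetric] using dpos by (intro prod_ennreal[symmetric]) auto
    finally show ?case by (simp only: v_def h_def)
  qed
qed

end

section \<open>Supplying the clamped drift, the potential and the slope bound\<close>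

lemma clamped_drift_exists:
  assumes sg: "0 < \<sigma>" and lam: "lam \<in> class_D" and a: "0 \<le> a" "a < 1/2" and C: "0 \<le> C"
    and sb: "\<And>y. slope_q lam y \<le> (1 - 2 * a) * (lam y)\<^sup>2 / \<sigma>\<^sup>2 + C"
    and V: "\<And>y. (V has_real_derivative (- lam y / \<sigma>\<^sup>2)) (at y)" "\<And>y. 0 \<le> V y" and R: "0 \<le> R"
  obtains B L lr where "clamped_drift \<sigma> a C B L R lam lr V"
proof -
  define Q where "Q = R + 1"
  \<comment> \<open>Clamping the argument of \<open>lam\<close>: the projection onto
    \<open>[-Q,Q]\<close> is 1-Lipschitz, so the bound and the Lipschitz constant of
    \<open>lam\<close> on this compact interval carry over to the whole line.\<close>
  define cl where "cl y = max (- Q) (min Q y)" for y :: real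
  define lr where "lr y = lam (cl y)" for y
  have clQ: "cl y \<in> {-Q..Q}" for y using R by (auto simp: cl_def Q_def)
  have cl1: "\<bar>cl y - cl z\<bar> \<le> \<bar>y - z\<bar>" for y z by (auto simp: cl_def max_def min_def)
  have "bounded (lam ` {-Q..Q})"
    by (intro compact_imp_bounded compact_continuous_image continuous_on_subset[OF class_D_continuous[OF lam]]) auto
  then obtain B where B: "\<And>y. y \<in> {-Q..Q} \<Longrightarrow> \<bar>lam y\<bar> \<le> B"
    unfolding bounded_iff by fastforce
  have "bounded (deriv lam ` {-Q..Q})"
    by (intro compact_imp_bounded compact_continuous_image continuous_on_subset[OF class_D_has_deriv(2)[OF lam]]) auto
  then obtain L where L: "0 < L" "\<And>y. y \<in> {-Q..Q} \<Longrightarrow> \<bar>deriv lam y\<bar> \<le> L" by (auto simp: bounded_pos)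
  have lip: "\<bar>lam y - lam z\<bar> \<le> L * \<bar>y - z\<bar>" if "y \<in> {-Q..Q}" "z \<in> {-Q..Q}" for y z
    using field_differentiable_bound[of "{-Q..Q}" lam "deriv lam" L z y] that L(2)
      has_field_derivative_at_within[OF class_D_has_deriv(1)[OF lam]]
    by (auto simp: abs_minus_commute)
  have "clamped_drift \<sigma> a C B L R lam lr V"
  proof
    show "0 \<le> B" using B[OF clQ[of 0]] by linarith
    show "\<bar>lr y\<bar> \<le> B" for y unfolding lr_def by (rule B[OF clQ])
    show "lr y = lam y" if "\<bar>y\<bar> \<le> R + 1" for y
      using that by (auto simp: lr_def cl_def Q_def min_def max_def)
    show "\<bar>lr y - lr z\<bar> \<le> L * \<bar>y - z\<bar>" for y z
    proof -
      have "\<bar>lr y - lr z\<bar> \<le> L * \<bar>cl y - cl z\<bar>" unfolding lr_def by (rule lip[OF clQ clQ])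
      also have "\<dots> \<le> L * \<bar>y - z\<bar>" using L cl1 by (intro mult_left_mono) auto
      finally show ?thesis .
    qed
    show "(lam has_real_derivative - slope_q lam y) (at y)" for y
      using class_D_has_deriv(1)[OF lam] by (simp add: slope_q_def)
  qed (use sg a C sb V L in auto)
  then show thesis by (rule that)
qed

text \<open>\<open>lam\<close> passes from positive to negative at its zero, so every antiderivative
  of \<open>- lam / \<sigma>\<^sup>2\<close> is minimal there; subtracting the minimum gives
  \<open>V\<close>.\<close>

lemma class_D_potential_exists:
  assumes lam: "lam \<in> class_D"
  obtains V where "\<And>y. (V has_real_derivative (- lam y / \<sigma>\<^sup>2)) (at y)" "\<And>y. 0 \<le> V y"
proof -
  obtain \<theta> where th: "lam \<theta> = 0" using lam by (auto simp: class_D_def)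
  \<comment> \<open>For \<open>\<sigma> = 0\<close> division by zero makes the integrand constantly
    0.\<close>
  have cont: "\<And>y. isCont (\<lambda>y. - lam y / \<sigma>\<^sup>2) y"
    using class_D_continuous[OF lam] by (cases "\<sigma> = 0") (auto intro!: continuous_intros simp: continuous_on_eq_continuous_at)
  obtain F where F: "\<And>y. (F has_real_derivative (- lam y / \<sigma>\<^sup>2)) (at y)"
  proof -
    have "\<exists>F. \<forall>y::real. (-\<infinity>::ereal) < y \<longrightarrow> y < (\<infinity>::ereal) \<longrightarrow> (F has_vector_derivative (- lam y / \<sigma>\<^sup>2)) (at y)"
      by (rule einterval_antiderivative) (use cont in auto)
    then show thesis using that by (auto simp: has_real_derivative_iff_has_vector_derivative)
  qed
  have "F \<theta> \<le> F y" for y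
  proof (cases "\<theta> \<le> y")
    case True
    show ?thesis
    proof (rule DERIV_nonneg_imp_nondecreasing[of \<theta> y F, OF True])
      fix u assume u: "\<theta> \<le> u" "u \<le> y"
      have "lam u \<le> lam \<theta>" using class_D_antimono[OF lam] u by (auto dest: antimonoD)
      then show "\<exists>D. (F has_real_derivative D) (at u) \<and> 0 \<le> D" using F[of u] th by (auto intro!: exI[of _ "- lam u / \<sigma>\<^sup>2"] divide_nonpos_nonneg)
    qed
  next
    case False
    show ?thesis
    proof (rule DERIV_nonpos_imp_nonincreasing[of y \<theta> F])
      show "y \<le> \<theta>" using False by simp
      fix u assume u: "y \<le> u" "u \<le> \<theta>"
      have "lam \<theta> \<le> lam u" using class_D_antimono[OF lam] u by (auto dest: antimonoD)
      then show "\<exists>D. (F has_real_derivative D) (at u) \<and> D \<le> 0" using F[of u] th by (auto intro!: exI[of _ "- lam u / \<sigma>\<^sup>2"] divide_nonneg_nonneg)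
    qed
  qed
  then show thesis
    by (intro that[of "\<lambda>y. F y - F \<theta>"]) (auto intro!: derivative_eq_intros F)
qed

lemma class_D_star_slope_bound:
  assumes lam: "lam \<in> class_D_star \<sigma>" and sg: "0 < \<sigma>" and e: "0 < e"
  obtains C where "0 \<le> C" "\<And>y. slope_q lam y \<le> e * (lam y)\<^sup>2 / \<sigma>\<^sup>2 + C"
proof -
  have D: "lam \<in> class_D" and dd: "drift_dominated \<sigma> lam" using lam by (auto simp: class_D_star_def)
  obtain \<theta> where th: "lam \<theta> = 0" using D by (auto simp: class_D_def)
  obtain b where b: "0 \<le> b" "\<And>y. b \<le> \<bar>y\<bar> \<Longrightarrow> \<sigma>\<^sup>2 * slope_q lam y / (lam y)\<^sup>2 < e"
    using drift_dominated_bound[OF dd e] by blast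
  \<comment> \<open>The margin keeps far points off the zero of \<open>lam\<close>, where division
    by zero makes the dominated quotient 0 and says nothing about the slope.\<close>
  define b' where "b' = max b (\<bar>\<theta>\<bar> + 1)"
  have "bounded (deriv lam ` {-b'..b'})"
    by (intro compact_imp_bounded compact_continuous_image continuous_on_subset[OF class_D_has_deriv(2)[OF D]]) auto
  then obtain C where C: "0 < C" "\<And>y. y \<in> {-b'..b'} \<Longrightarrow> \<bar>deriv lam y\<bar> \<le> C" by (auto simp: bounded_pos)
  have "slope_q lam y \<le> e * (lam y)\<^sup>2 / \<sigma>\<^sup>2 + C" for y
  proof (cases "\<bar>y\<bar> \<le> b'")
    case True
    then have "\<bar>deriv lam y\<bar> \<le> C" by (intro C(2)) auto
    then have "slope_q lam y \<le> C" unfolding slope_q_def by linarith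
    moreover have "0 \<le> e * (lam y)\<^sup>2 / \<sigma>\<^sup>2" using e by simp
    ultimately show ?thesis by linarith
  next
    case False
    then have far: "b \<le> \<bar>y\<bar>" and "y \<noteq> \<theta>" by (auto simp: b'_def max_def split: if_splits)
    then have "lam y \<noteq> 0" using class_D_less[OF D, of y \<theta>] class_D_less[OF D, of \<theta> y] th by (cases "y < \<theta>") auto
    then have "slope_q lam y \<le> e * (lam y)\<^sup>2 / \<sigma>\<^sup>2" using b(2)[of y] far sg by (auto simp: field_simps)
    then show ?thesis using C by simp
  qed
  with C show thesis by (intro that[of C]) auto
qed

text \<open>Localisation to paths bounded by \<open>k\<close> is an almost sure implication rather
  than a stopping time. The constant \<open>c\<close> is the same for every \<open>k\<close>, so the
  variables \<open>H k\<close>, all of mean at most 1, dominate the functional up to the single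
  factor \<open>exp c\<close>.\<close>

lemma drift_exp_moment_finite:
  assumes sg: "0 < \<sigma>" and lam: "lam \<in> class_D_star \<sigma>" and W: "standard_brownian_motion M W"
    and X: "strong_solution M W lam \<sigma> x X" and a: "0 \<le> a" "a < 1/2" and T: "0 < T"
  shows "drift_exp_moment M lam \<sigma> X a T < \<infinity>"
proof -
  interpret prob_space M using W by (simp add: standard_brownian_motion_def)
  have D: "lam \<in> class_D" using lam by (simp add: class_D_star_def)
  obtain C where C: "0 \<le> C" "\<And>y. slope_q lam y \<le> (1 - 2 * a) * (lam y)\<^sup>2 / \<sigma>\<^sup>2 + C"
    using class_D_star_slope_bound[OF lam sg, of "1 - 2 * a"] a by auto
  obtain V where V: "\<And>y. (V has_real_derivative (- lam y / \<sigma>\<^sup>2)) (at y)" "\<And>y. 0 \<le> V y"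
    using class_D_potential_exists[OF D] by blast
  define c where "c = V x + (C + 1) / 2 * T + 2"
  define I where "I \<omega> = exp (a * (LINT s:{0..T}|lborel. (lam (X s \<omega>))\<^sup>2 / \<sigma>\<^sup>2))" for \<omega>
  have Xc: "AE \<omega> in M. continuous_on {0..} (\<lambda>t. X t \<omega>)"
    and Xe: "AE \<omega> in M. \<forall>t\<ge>0. X t \<omega> = x + (LINT s:{0..t}|lborel. lam (X s \<omega>)) + \<sigma> * W t \<omega>"
    using X by (auto simp: strong_solution_def)
  have W0: "AE \<omega> in M. W 0 \<omega> = 0" using W by (simp add: standard_brownian_motion_def)
  have "\<exists>H. H \<in> borel_measurable M \<and> (\<integral>\<^sup>+\<omega>. H \<omega> \<partial>M) \<le> 1 \<and>
    (AE \<omega> in M. (\<forall>t\<in>{0..T}. \<bar>X t \<omega>\<bar> \<le> real k) \<longrightarrow> ennreal (I \<omega> * exp (- c)) \<le> H \<omega>)" for k :: nat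
  proof -
    obtain B L lr where "clamped_drift \<sigma> a C B L (real k) lam lr V"
      using clamped_drift_exists[OF sg D a C V, of "real k"] by auto
    then interpret clamped_drift \<sigma> a C B L "real k" lam lr V .
    have "(\<lambda>n. (quad_bound * T) / real n) \<longlonglongrightarrow> 0" by (rule lim_const_over_n)
    then have "eventually (\<lambda>n. (quad_bound * T) / real n < 1/2) sequentially"
      by (rule order_tendstoD) simp
    then obtain n0 where n0: "\<And>n. n0 \<le> n \<Longrightarrow> quad_bound * (T / real n) \<le> 1/2"
      by (auto simp: eventually_sequentially intro: less_imp_le)
    define ph where "ph h = (\<lambda>y \<xi>. ennreal (girsanov_factor h y \<xi>))" for h
    \<comment> \<open>Restriction to \<open>{..<n}\<close> places the increments in the product
      space that carries their joint law; the weight reads no other coordinate.\<close>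
    define G where "G n \<omega> = path_weight x (euler_step (T / real n)) (ph (T / real n)) n
        (\<lambda>i\<in>{..<n}. W (real (Suc i) * (T / real n)) \<omega> - W (real i * (T / real n)) \<omega>)" for n \<omega>
    \<comment> \<open>The shift makes every term have mean 1: it ensures a positive number of steps
      and a fine enough mesh.\<close>
    define N where "N n = n + n0 + 1" for n :: nat
    have phm: "case_prod (ph h) \<in> borel_measurable (borel \<Otimes>\<^sub>M borel)" for h
      using girsanov_factor_measurable[of h] by (simp add: ph_def split_beta')
    have G: "G n \<in> borel_measurable M \<and> (\<integral>\<^sup>+\<omega>. G n \<omega> \<partial>M) = 1" if n: "0 < n" "n0 \<le> n" for n
    proof -
      have h: "0 < T / real n" using T n by simp
      note inc = standard_brownian_motion_increments[OF W h, of n]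
      have pm: "path_weight x (euler_step (T / real n)) (ph (T / real n)) n \<in> borel_measurable (Pi\<^sub>M {..<n} (\<lambda>_. borel))"
        by (intro measurable_path_weight euler_step_measurable phm refl)
      have m: "G n \<in> borel_measurable M"
        unfolding G_def by (rule measurable_compose[OF inc(1) pm])
      have "(\<integral>\<^sup>+\<omega>. G n \<omega> \<partial>M) = (\<integral>\<^sup>+v. path_weight x (euler_step (T / real n)) (ph (T / real n)) n v \<partial>Pi\<^sub>M {..<n} (\<lambda>_. gauss (T / real n)))"
        unfolding G_def inc(2)[OF n(1), symmetric] by (subst nn_integral_distr[OF inc(1)]) (simp_all add: pm)
      also have "\<dots> = 1" unfolding ph_def by (rule nn_integral_path_weight_girsanov_factor[OF h n0[OF n(2)]])
      finally show ?thesis using m by blast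
    qed
    define H where "H \<omega> = liminf (\<lambda>n. G (N n) \<omega>)" for \<omega>
    have GN[measurable]: "G (N n) \<in> borel_measurable M" for n using G[of "N n"] by (simp add: N_def)
    have "H \<in> borel_measurable M" unfolding H_def by measurable
    moreover have "(\<integral>\<^sup>+\<omega>. H \<omega> \<partial>M) \<le> 1"
    proof -
      have "(\<integral>\<^sup>+\<omega>. H \<omega> \<partial>M) \<le> liminf (\<lambda>n. \<integral>\<^sup>+\<omega>. G (N n) \<omega> \<partial>M)"
        unfolding H_def by (rule nn_integral_liminf) (rule GN)
      also have "\<dots> = 1" using G by (simp add: N_def Liminf_const)
      finally show ?thesis .
    qed
    moreover have "AE \<omega> in M. (\<forall>t\<in>{0..T}. \<bar>X t \<omega>\<bar> \<le> real k) \<longrightarrow> ennreal (I \<omega> * exp (- c)) \<le> H \<omega>"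
      using Xc Xe W0
    proof eventually_elim
      case (elim \<omega>)
      show ?case
      proof
        assume b: "\<forall>t\<in>{0..T}. \<bar>X t \<omega>\<bar> \<le> real k"
        have "eventually (\<lambda>n. ennreal (exp (a * (LINT s:{0..T}|lborel. (lam (X s \<omega>))\<^sup>2 / \<sigma>\<^sup>2) - c))
          \<le> path_weight x (euler_step (T / real n)) (\<lambda>y \<xi>. ennreal (girsanov_factor (T / real n) y \<xi>)) n
          (\<lambda>i. W (real (Suc i) * (T / real n)) \<omega> - W (real i * (T / real n)) \<omega>)) sequentially"
          unfolding c_def
        proof (rule eventually_path_weight_ge[OF T _ class_D_continuous[OF D]])
          show "continuous_on {0..T} (\<lambda>t. X t \<omega>)" using elim(1) by (rule continuous_on_subset) auto
        qed (use elim b in auto)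
        moreover have "path_weight x (euler_step (T / real n)) (\<lambda>y \<xi>. ennreal (girsanov_factor (T / real n) y \<xi>)) n
          (\<lambda>i. W (real (Suc i) * (T / real n)) \<omega> - W (real i * (T / real n)) \<omega>) = G n \<omega>" for n
          unfolding G_def ph_def path_weight_def by (intro prod.cong refl arg_cong2[where f = "\<lambda>y \<xi>. ennreal (girsanov_factor (T / real n) y \<xi>)"] chain_cong) auto
        ultimately have "eventually (\<lambda>n. ennreal (I \<omega> * exp (- c)) \<le> G n \<omega>) sequentially"
          by (simp add: I_def exp_diff exp_minus divide_inverse)
        then have "eventually (\<lambda>n. ennreal (I \<omega> * exp (- c)) \<le> G (n + (n0 + 1)) \<omega>) sequentially"
          by (rule eventually_all_ge_at_top[THEN eventually_mono, THEN eventually_sequentially_seg[THEN iffD2]]) simp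
        then have "eventually (\<lambda>n. ennreal (I \<omega> * exp (- c)) \<le> G (N n) \<omega>) sequentially"
          by (simp add: N_def add.assoc)
        then show "ennreal (I \<omega> * exp (- c)) \<le> H \<omega>" unfolding H_def by (rule Liminf_bounded)
      qed
    qed
    ultimately show ?thesis by blast
  qed
  then have "\<exists>H. \<forall>k::nat. H k \<in> borel_measurable M \<and> (\<integral>\<^sup>+\<omega>. H k \<omega> \<partial>M) \<le> 1 \<and>
    (AE \<omega> in M. (\<forall>t\<in>{0..T}. \<bar>X t \<omega>\<bar> \<le> real k) \<longrightarrow> ennreal (I \<omega> * exp (- c)) \<le> H k \<omega>)"
    by (intro choice allI)
  then obtain H where Hm[measurable]: "\<And>k::nat. H k \<in> borel_measurable M" and H1: "\<And>k. (\<integral>\<^sup>+\<omega>. H k \<omega> \<partial>M) \<le> 1"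
    and HI: "\<And>k. AE \<omega> in M. (\<forall>t\<in>{0..T}. \<bar>X t \<omega>\<bar> \<le> real k) \<longrightarrow> ennreal (I \<omega> * exp (- c)) \<le> H k \<omega>"
    by blast
  have "AE \<omega> in M. \<forall>k. (\<forall>t\<in>{0..T}. \<bar>X t \<omega>\<bar> \<le> real k) \<longrightarrow> ennreal (I \<omega> * exp (- c)) \<le> H k \<omega>"
    by (subst AE_all_countable) (intro allI HI)
  \<comment> \<open>A continuous path is bounded on \<open>[0,T]\<close>, so almost surely the
    domination by \<open>H k\<close> holds from some level on and passes to the lower limit.\<close>
  then have "AE \<omega> in M. ennreal (I \<omega>) \<le> ennreal (exp c) * liminf (\<lambda>k. H k \<omega>)"
    using Xc
  proof eventually_elim
    case (elim \<omega>)
    have "continuous_on {0..T} (\<lambda>t. X t \<omega>)" using elim(2) by (rule continuous_on_subset) auto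
    then have "bounded ((\<lambda>t. X t \<omega>) ` {0..T})"
      by (intro compact_imp_bounded compact_continuous_image) auto
    then obtain b where b: "\<And>t. t \<in> {0..T} \<Longrightarrow> \<bar>X t \<omega>\<bar> \<le> b"
      unfolding bounded_iff by fastforce
    obtain k0 :: nat where k0: "b \<le> real k0" using real_arch_simple by blast
    have "eventually (\<lambda>k. ennreal (I \<omega> * exp (- c)) \<le> H k \<omega>) sequentially"
      using eventually_ge_at_top[of k0]
    proof eventually_elim
      case k: (elim k)
      have "\<bar>X t \<omega>\<bar> \<le> real k" if "t \<in> {0..T}" for t
        using b[OF that] k0 k by linarith
      then show ?case using elim(1) by blast
    qed
    then have "ennreal (I \<omega> * exp (- c)) \<le> liminf (\<lambda>k. H k \<omega>)" by (rule Liminf_bounded)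
    then have "ennreal (exp c) * ennreal (I \<omega> * exp (- c)) \<le> ennreal (exp c) * liminf (\<lambda>k. H k \<omega>)"
      by (rule mult_left_mono) simp
    moreover have "ennreal (exp c) * ennreal (I \<omega> * exp (- c)) = ennreal (I \<omega>)"
      by (simp add: exp_minus field_simps flip: ennreal_mult')
    ultimately show ?case by simp
  qed
  then have "drift_exp_moment M lam \<sigma> X a T \<le> (\<integral>\<^sup>+\<omega>. ennreal (exp c) * liminf (\<lambda>k. H k \<omega>) \<partial>M)"
    unfolding drift_exp_moment_def I_def by (rule nn_integral_mono_AE)
  also have "\<dots> = ennreal (exp c) * (\<integral>\<^sup>+\<omega>. liminf (\<lambda>k. H k \<omega>) \<partial>M)"
    by (rule nn_integral_cmult) measurable
  also have "\<dots> \<le> ennreal (exp c) * liminf (\<lambda>k. \<integral>\<^sup>+\<omega>. H k \<omega> \<partial>M)"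
    by (intro mult_left_mono nn_integral_liminf Hm) simp
  also have "\<dots> \<le> ennreal (exp c) * liminf (\<lambda>k::nat. 1)"
    by (intro mult_left_mono Liminf_mono always_eventually allI H1) simp
  also have "\<dots> < \<infinity>" by (simp add: Liminf_const)
  finally show ?thesis .
qed

theorem corollary3p6:
  fixes M :: "'w measure" and W X :: "real \<Rightarrow> 'w \<Rightarrow> real"
    and lam :: "real \<Rightarrow> real" and \<sigma> x :: real
  assumes "\<sigma> > 0"
    and "lam \<in> class_D_star \<sigma>"
    and "standard_brownian_motion M W"
    and "strong_solution M W lam \<sigma> x X"
  shows "(\<forall>a. 0 \<le> a \<and> a < 1/2 \<longrightarrow> (\<forall>T>0. drift_exp_moment M lam \<sigma> X a T < \<infinity>)) \<and>
    (\<forall>a>1/2. \<forall>T>0. drift_exp_moment M lam \<sigma> X a T = \<infinity>) \<and>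
    (\<forall>a\<ge>0. (\<exists>S>0. \<exists>T>0. drift_exp_moment M lam \<sigma> X a S < \<infinity> \<and>
                         drift_exp_moment M lam \<sigma> X a T = \<infinity>) \<longrightarrow> a = 1/2)"
proof -
  have fin: "drift_exp_moment M lam \<sigma> X a T < \<infinity>" if "0 \<le> a" "a < 1/2" "0 < T" for a T
    using drift_exp_moment_finite[OF assms] that by blast
  have inf: "drift_exp_moment M lam \<sigma> X a T = \<infinity>" if "1/2 < a" "0 < T" for a T
    using drift_exp_moment_infinite[OF assms] that by blast
  \<comment> \<open>Below 1/2 the infinite value at \<open>T\<close> is contradicted, above it the
    finite value at \<open>S\<close>.\<close>
  have "a = 1/2" if "0 \<le> a" "0 < S" "0 < T" "drift_exp_moment M lam \<sigma> X a S < \<infinity>"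
    "drift_exp_moment M lam \<sigma> X a T = \<infinity>" for a S T
    using fin[of a T] inf[of a S] that by (cases a "1/2 :: real" rule: linorder_cases) auto
  with fin inf show ?thesis by blast
qed

end
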